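(* The generalized Riemannian space $\mathbb{GR}_N$ admits a nontrivial geodesic mapping onto the generalized Kählerian space of the first kind $\mathbb{G}\overline{\underset{1}{\mathbb{K}}}{}_N$ if and only if, in the common coordinate system $x$ with respect to the mapping, the conditions $$\text{a)}\quad \overline g_{ij\underset{3}{|}k}=\overline g_{\underset{\vee}{ij}\,\underset{3}{\overline{|}}\,k}+2\psi_k\overline g_{ij}+\psi_i\overline g_{jk}+\psi_j\overline g_{ik}+\xi^\alpha_{ik}\overline g_{\alpha j}+\xi^\alpha_{kj}\overline g_{i\alpha},$$ $$\text{b)}\quad \overline F^h_{i\underset{3}{|}k}=\overline F^h_{i\,\underset{3}{\overline{|}}\,k}-\psi_p\delta^h_k\overline F^p_i+\psi_i\overline F^h_k-\xi^h_{pk}\overline F^p_i+\xi^p_{ki}\overline F^h_p$$ hold with respect to the third kind of covariant derivative, where $\psi_i\neq0$ and the tensors $\overline g_{ij}$ and $\overline F^h_i$ satisfy $$\det(\overline g_{\underline{ij}})\neq0,\qquad \overline F^\alpha_i\overline g_{\underline{\alpha j}}+\overline F^\alpha_j\overline g_{\underline{\alpha i}}=0,\qquad \overline F^h_\alpha\overline F^\alpha_i=-\delta^h_i .$$ Then $\overline g_{ij}$ and $\overline F^h_i$ are the metric tensor and the structure of $\mathbb{G}\overline{\underset{1}{\mathbb{K}}}{}_N$, respectively.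
   Context: Summation convention is used. A generalized Riemannian space $\mathbb{GR}_N$ is a differentiable $N$-dimensional manifold with a non-symmetric basic tensor $g_{ij}$; put $g_{\underline{ij}}=\frac12(g_{ij}+g_{ji})$ and $g_{\underset{\vee}{ij}}=\frac12(g_{ij}-g_{ji})$, assume $\det(g_{\underline{ij}})\neq0$, and let $(g^{\underline{ij}})$ be the inverse matrix of $(g_{\underline{ij}})$. Its connection coefficients are $\Gamma^i_{jk}=g^{\underline{ip}}\Gamma_{p.jk}$ with $\Gamma_{i.jk}=\frac12(g_{ji,k}-g_{jk,i}+g_{ik,j})$ (comma = partial derivative); in general $\Gamma^i_{jk}\neq\Gamma^i_{kj}$. Put $\Gamma^i_{\underline{jk}}=\frac12(\Gamma^i_{jk}+\Gamma^i_{kj})$. The covariant derivatives of the first and third kind of a tensor $a^i_j$ are $a^i_{j\underset{1}{|}m}=a^i_{j,m}+\Gamma^i_{pm}a^p_j-\Gamma^p_{jm}a^i_p$ and $a^i_{j\underset{3}{|}m}=a^i_{j,m}+\Gamma^i_{pm}a^p_j-\Gamma^p_{mj}a^i_p$; for tensors of other type each upper index contributes a term like that of $i$ and each lower index a term like that of $j$. A generalized Kählerian space of the first kind is a generalized Riemannian space together with an almost complex structure $F^i_j$ (the structure) such that $F^h_pF^p_i=-\delta^h_i$, $g_{\underline{pq}}F^p_iF^q_j=g_{\underline{ij}}$, $g^{\underline{ij}}=g^{\underline{pq}}F^i_pF^j_q$, $F^h_{i\underset{1}{|}j}=0$ and $F^h_{i;j}=0$, where $(;)$ is the covariant derivative with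 respect to $\Gamma^i_{\underline{jk}}$. A diffeomorphism $f$ from $\mathbb{GR}_N$ onto $\mathbb{G}\overline{\underset{1}{\mathbb{K}}}{}_N$ is geodesic if it maps geodesics to geodesics. Points corresponding under $f$ are given the same coordinates (common coordinate system $x$). Barred objects belong to the target: $\overline\Gamma^i_{jk}$ are its connection coefficients, built from $\overline g_{ij}$ by the formulas above, $\overline g_{\underline{ij}}$ and $\overline g_{\underset{\vee}{ij}}$ are the symmetric and antisymmetric parts of $\overline g_{ij}$, and $\underset{3}{|}$, $\underset{3}{\overline{|}}$ are the covariant derivatives of the third kind with respect to $\Gamma$ and $\overline\Gamma$. With $P^i_{jk}=\overline\Gamma^i_{jk}-\Gamma^i_{jk}$ put $\xi^i_{jk}=\frac12(P^i_{jk}-P^i_{kj})$ and $\psi_i=\frac1{N+1}(\overline\Gamma^\alpha_{i\alpha}-\Gamma^\alpha_{i\alpha})$. The mapping is geodesic exactly when $P^i_{jk}=\delta^i_j\psi_k+\delta^i_k\psi_j+\xi^i_{jk}$; a geodesic mapping is nontrivial if $\psi_i\neq0$.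
   Formalization: In a) the terms ψ_i ḡ_jk and ξ^α_ik ḡ_αj are corrected to ψ_i ḡ_kj and ξ^α_ki ḡ_αj (the printed form fails for nonsymmetric ḡ or ξ≠0), and the parallelism of F̄ (F̄_{|1}=0 and F̄_{;}=0 in the target) is assumed, since the listed conditions do not imply it. *)

theory Defs
  imports "HOL-Analysis.Analysis"
begin

text \<open>
  Both spaces are described in the common coordinate system of the mapping, whose range is an
  open set \<open>U\<close> of \<open>real ^ 'n\<close> with \<open>N = CARD('n)\<close>; corresponding points have equal coordinates,
  so the diffeomorphism is the identity of \<open>U\<close> and a second space is a second family of tensor
  components on \<open>U\<close>.

  Index conventions: \<open>g x $ i $ j\<close> is \<open>g_ij\<close>, \<open>F x $ h $ i\<close> is \<open>F^h_i\<close>, and for connection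
  coefficients (and all objects with one upper and two lower indices) \<open>C x i j k\<close> is
  \<open>C^i_jk\<close>, the upper index coming first.
\<close>

type_synonym 'n field2 = "real ^ 'n \<Rightarrow> real ^ 'n ^ 'n"
type_synonym 'n field3 = "real ^ 'n \<Rightarrow> 'n \<Rightarrow> 'n \<Rightarrow> 'n \<Rightarrow> real"

definition pdiff :: "'n::finite \<Rightarrow> (real ^ 'n \<Rightarrow> real) \<Rightarrow> real ^ 'n \<Rightarrow> real" where
  "pdiff k f x = frechet_derivative f (at x) (axis k 1)"

fun C_diff :: "nat \<Rightarrow> (real ^ 'n::finite) set \<Rightarrow> (real ^ 'n \<Rightarrow> real) \<Rightarrow> bool" where
  "C_diff 0 U f \<longleftrightarrow> continuous_on U f"
| "C_diff (Suc m) U f \<longleftrightarrow> f differentiable_on U \<and> (\<forall>k. C_diff m U (pdiff k f))"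

definition smooth_field2 :: "(real ^ 'n::finite) set \<Rightarrow> 'n field2 \<Rightarrow> bool" where
  "smooth_field2 U T \<longleftrightarrow> (\<forall>m i j. C_diff m U (\<lambda>x. T x $ i $ j))"

definition sym_part :: "real ^ 'n ^ 'n \<Rightarrow> real ^ 'n ^ 'n" where
  "sym_part A = (\<chi> i j. (A $ i $ j + A $ j $ i) / 2)"

definition alt_part :: "real ^ 'n ^ 'n \<Rightarrow> real ^ 'n ^ 'n" where
  "alt_part A = (\<chi> i j. (A $ i $ j - A $ j $ i) / 2)"

text \<open>The basic tensor is not required to be symmetric; ordinary (pseudo-)Riemannian metrics
  are included.\<close>

definition gen_Riemannian :: "(real ^ 'n::finite) set \<Rightarrow> 'n field2 \<Rightarrow> bool" where
  "gen_Riemannian U g \<longleftrightarrow>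
     open U \<and> smooth_field2 U g \<and> (\<forall>x\<in>U. det (sym_part (g x)) \<noteq> 0)"

definition Gamma_low :: "'n::finite field2 \<Rightarrow> 'n field3" where
  "Gamma_low g x i j k =
     (pdiff k (\<lambda>y. g y $ j $ i) x - pdiff i (\<lambda>y. g y $ j $ k) x + pdiff j (\<lambda>y. g y $ i $ k) x) / 2"

definition Gamma :: "'n::finite field2 \<Rightarrow> 'n field3" where
  "Gamma g x i j k = (\<Sum>p\<in>UNIV. matrix_inv (sym_part (g x)) $ i $ p * Gamma_low g x p j k)"

definition sym_conn :: "'n field3 \<Rightarrow> 'n field3" where
  "sym_conn C x i j k = (C x i j k + C x i k j) / 2"

text \<open>
  Covariant derivatives with respect to the coefficients \<open>C\<close>; the last index is the one of
  differentiation. The suffix \<open>11\<close> is for one upper and one lower index, \<open>02\<close> for two lower ones.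
  Every lower index \<open>j\<close> enters the third kind as \<open>C^p_mj\<close>, differentiation index first. This
  fixes the index order of the terms with \<open>\<psi>_i\<close> and \<open>\<xi>\<close> in condition a) of the theorem:
  they read \<open>\<psi>_i gbar_kj\<close>, \<open>\<xi>^a_ki gbar_aj\<close> and \<open>\<xi>^a_kj gbar_ia\<close>. With \<open>gbar_jk\<close> or \<open>\<xi>^a_ik\<close>
  the condition fails for geodesic mappings onto flat Kaehlerian spaces.
\<close>

definition cov1_11 :: "'n::finite field3 \<Rightarrow> 'n field2 \<Rightarrow> 'n field3" where
  "cov1_11 C a x i j m =
     pdiff m (\<lambda>y. a y $ i $ j) x + (\<Sum>p\<in>UNIV. C x i p m * a x $ p $ j)
       - (\<Sum>p\<in>UNIV. C x p j m * a x $ i $ p)"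

definition cov3_11 :: "'n::finite field3 \<Rightarrow> 'n field2 \<Rightarrow> 'n field3" where
  "cov3_11 C a x i j m =
     pdiff m (\<lambda>y. a y $ i $ j) x + (\<Sum>p\<in>UNIV. C x i p m * a x $ p $ j)
       - (\<Sum>p\<in>UNIV. C x p m j * a x $ i $ p)"

definition cov3_02 :: "'n::finite field3 \<Rightarrow> 'n field2 \<Rightarrow> 'n field3" where
  "cov3_02 C a x i j m =
     pdiff m (\<lambda>y. a y $ i $ j) x - (\<Sum>p\<in>UNIV. C x p m i * a x $ p $ j)
       - (\<Sum>p\<in>UNIV. C x p m j * a x $ i $ p)"

text \<open>
  The differential conditions in the definition of a generalized Kaehlerian space of the first
  kind: the structure is parallel for the first kind of covariant derivative and for the
  derivative with respect to the symmetrized connection, for which all kinds coincide.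
\<close>

definition structure_parallel :: "(real ^ 'n::finite) set \<Rightarrow> 'n field2 \<Rightarrow> 'n field2 \<Rightarrow> bool" where
  "structure_parallel U g F \<longleftrightarrow>
     (\<forall>x\<in>U. \<forall>h i j. cov1_11 (Gamma g) F x h i j = 0 \<and> cov1_11 (sym_conn (Gamma g)) F x h i j = 0)"

definition gen_Kaehler1 :: "(real ^ 'n::finite) set \<Rightarrow> 'n field2 \<Rightarrow> 'n field2 \<Rightarrow> bool" where
  "gen_Kaehler1 U g F \<longleftrightarrow>
     gen_Riemannian U g \<and> smooth_field2 U F \<and>
     (\<forall>x\<in>U. \<forall>h i. (\<Sum>p\<in>UNIV. F x $ h $ p * F x $ p $ i) = (if h = i then -1 else 0)) \<and>
     (\<forall>x\<in>U. \<forall>i j. (\<Sum>p\<in>UNIV. \<Sum>q\<in>UNIV. sym_part (g x) $ p $ q * F x $ p $ i * F x $ q $ j)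
        = sym_part (g x) $ i $ j) \<and>
     (\<forall>x\<in>U. \<forall>i j. matrix_inv (sym_part (g x)) $ i $ j
        = (\<Sum>p\<in>UNIV. \<Sum>q\<in>UNIV. matrix_inv (sym_part (g x)) $ p $ q * F x $ i $ p * F x $ j $ q)) \<and>
     structure_parallel U g F"

text \<open>
  Geodesics are regular \<open>C^2\<close> curves in an arbitrary parameter (a geodesic mapping need not
  preserve affine parameters), so the acceleration is only required to be proportional
  to the velocity.
\<close>

definition geodesic ::
  "(real ^ 'n::finite) set \<Rightarrow> 'n field2 \<Rightarrow> real set \<Rightarrow> (real \<Rightarrow> real ^ 'n) \<Rightarrow> bool" where
  "geodesic U g J \<gamma> \<longleftrightarrow>
     open J \<and> is_interval J \<and> J \<noteq> {} \<and> \<gamma> ` J \<subseteq> U \<and>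
     (\<exists>v a \<rho>. continuous_on J a \<and>
       (\<forall>t\<in>J. (\<gamma> has_vector_derivative v t) (at t) \<and> (v has_vector_derivative a t) (at t) \<and>
          v t \<noteq> 0 \<and>
          (\<forall>i. a t $ i + (\<Sum>j\<in>UNIV. \<Sum>k\<in>UNIV. Gamma g (\<gamma> t) i j k * v t $ j * v t $ k)
               = \<rho> t * v t $ i)))"

definition geodesic_mapping :: "(real ^ 'n::finite) set \<Rightarrow> 'n field2 \<Rightarrow> 'n field2 \<Rightarrow> bool" where
  "geodesic_mapping U g gbar \<longleftrightarrow> (\<forall>J \<gamma>. geodesic U g J \<gamma> \<longrightarrow> geodesic U gbar J \<gamma>)"

definition deform :: "'n::finite field2 \<Rightarrow> 'n field2 \<Rightarrow> 'n field3" where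
  "deform g gbar x i j k = Gamma gbar x i j k - Gamma g x i j k"

definition xi :: "'n::finite field2 \<Rightarrow> 'n field2 \<Rightarrow> 'n field3" where
  "xi g gbar x i j k = (deform g gbar x i j k - deform g gbar x i k j) / 2"

definition psi :: "'n::finite field2 \<Rightarrow> 'n field2 \<Rightarrow> real ^ 'n \<Rightarrow> 'n \<Rightarrow> real" where
  "psi g gbar x i =
     (\<Sum>\<alpha>\<in>UNIV. Gamma gbar x \<alpha> i \<alpha> - Gamma g x \<alpha> i \<alpha>) / (real CARD('n) + 1)"

text \<open>\<open>\<psi>_i \<noteq> 0\<close> is a statement about the covector field: it does not vanish identically.\<close>

definition psi_nonzero :: "(real ^ 'n::finite) set \<Rightarrow> 'n field2 \<Rightarrow> 'n field2 \<Rightarrow> bool" where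
  "psi_nonzero U g gbar \<longleftrightarrow> (\<exists>x\<in>U. \<exists>i. psi g gbar x i \<noteq> 0)"

definition nontrivial_geodesic_mapping ::
  "(real ^ 'n::finite) set \<Rightarrow> 'n field2 \<Rightarrow> 'n field2 \<Rightarrow> bool" where
  "nontrivial_geodesic_mapping U g gbar \<longleftrightarrow> geodesic_mapping U g gbar \<and> psi_nonzero U g gbar"

end

theory Submission
  imports Defs
begin

text \<open>
  Everything is governed by the deformation \<open>P = \<Gamma>bar - \<Gamma>\<close>, and by whether it has the form
  \<open>P^i_jk = \<delta>^i_j \<psi>_k + \<delta>^i_k \<psi>_j + \<xi>^i_jk\<close>, called \<open>geodesic_deformation\<close> below. When the
  symmetric part of \<open>gbar\<close> is nondegenerate on \<open>U\<close>, both the geodesic property of the mapping and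
  condition a) are equivalent to this form of \<open>P\<close> at every point of \<open>U\<close>. Condition b) then follows.

  \<^emph>\<open>Condition a).\<close> The symmetric part of \<open>gbar\<close> is parallel for the third kind of covariant
  derivative with respect to \<open>\<Gamma>bar\<close>. Hence the difference of the two covariant derivatives in a) is
  purely algebraic in \<open>P\<close> and \<open>gbar\<close>, and a) says that the tensor
  \<open>D^p_ki = P^p_ki - \<delta>^p_k \<psi>_i - \<delta>^p_i \<psi>_k - \<xi>^p_ki\<close>, symmetric in \<open>k\<close> and \<open>i\<close>, satisfies
  \<open>D^p_ki gbar_pj + D^p_kj gbar_ip = 0\<close>. By the argument that makes a torsion-free metric connection
  unique, such a \<open>D\<close> vanishes (\<open>metric_condition_iff_geodesic_deformation\<close>). Condition b) is a
  substitution of the form of \<open>P\<close> (\<open>structure_condition_of_geodesic_deformation\<close>).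

  \<^emph>\<open>Geodesics.\<close> If \<open>P\<close> has the form, then \<open>P(v,v) = 2 \<psi>(v) v\<close>, so that geodesics remain geodesics up
  to a change of the proportionality factor (\<open>deformation_imp_geodesic_mapping\<close>). Conversely, there
  is a geodesic through every point in every direction, so a geodesic mapping forces \<open>P(v,v)\<close> to be
  parallel to \<open>v\<close> for all \<open>v\<close>; polarization on coordinate vectors then gives the form with some
  covector (\<open>direction_preserving_form\<close>). A trace identifies this covector as \<open>\<psi>\<close>: the torsion of a
  generalized Riemannian space is totally antisymmetric, so \<open>\<xi>\<close> is trace-free
  (\<open>geodesic_mapping_imp_deformation\<close>). Existence of geodesics comes from Banach's fixed point
  theorem; the Lipschitz condition holds because the \<open>\<Gamma>^i_jk\<close> are rational expressions in the
  components of \<open>g\<close> and their first derivatives (\<open>geodesic_through_point_and_direction\<close>).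

  \<^emph>\<open>Structure.\<close> For \<open>F\<^sup>2 = -1\<close> invariance of a symmetric nondegenerate form under \<open>F\<close> is the
  same as skewness of \<open>F\<close> with respect to it, and both imply the invariance of the inverse form
  (\<open>hermitian_iff_skew\<close>, \<open>skew_imp_inverse_hermitian\<close>).
\<close>


section \<open>Local existence for autonomous differential equations\<close>

lemma norm_integral_diff_le:
  fixes h :: "real \<Rightarrow> 'a::euclidean_space"
  assumes h: "continuous_on UNIV h" and B: "\<And>s. norm (h s) \<le> B"
    and st: "a \<le> s" "a \<le> t"
  shows "norm (integral {a..t} h - integral {a..s} h) \<le> B * \<bar>t - s\<bar>"
proof -
  have *: "norm (integral {a..q} h - integral {a..p} h) \<le> B * (q - p)" if "a \<le> p" "p \<le> q" for p q
  proof -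
    have int: "h integrable_on {x..y}" for x y
      by (intro integrable_continuous_real continuous_on_subset[OF h]) auto
    have "integral {a..p} h + integral {p..q} h = integral {a..q} h"
      by (rule Henstock_Kurzweil_Integration.integral_combine[OF that int])
    then have "integral {a..q} h - integral {a..p} h = integral {p..q} h"
      by (simp add: algebra_simps)
    moreover have "norm (integral {p..q} h) \<le> B * (q - p)"
      using integral_bound[OF \<open>p \<le> q\<close> continuous_on_subset[OF h]] B by auto
    ultimately show ?thesis by simp
  qed
  show ?thesis
    using *[of s t] *[of t s] st by (cases "s \<le> t") (auto simp: norm_minus_commute)
qed

text \<open>
  The Picard operator is made a contraction of the space of all bounded continuous functions on the
  line by two modifications. The right-hand side is composed with the nearest-point projection onto
  the ball, which keeps it Lipschitz and makes it bounded by some \<open>M\<close>; time is clamped to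
  \<open>[-e, e]\<close>. The fixed point then moves by at most \<open>M e \<le> r\<close>, hence never leaves the ball and
  does not see the projection.
\<close>

lemma Picard_local_existence:
  fixes f :: "'a::euclidean_space \<Rightarrow> 'a"
  assumes r: "0 < r" and L: "L-lipschitz_on (cball y0 r) f"
  obtains e u where "0 < e" "u 0 = y0"
    "\<And>t. t \<in> {-e<..<e} \<Longrightarrow> u t \<in> cball y0 r"
    "\<And>t. t \<in> {-e<..<e} \<Longrightarrow> (u has_vector_derivative f (u t)) (at t)"
proof -
  define F where "F x = f (closest_point (cball y0 r) x)" for x
  have cp: "closest_point (cball y0 r) x \<in> cball y0 r" for x
    using r by (intro closest_point_in_set) auto
  have L0: "0 \<le> L" using L by (rule lipschitz_on_nonneg)
  have dF: "dist (F x) (F y) \<le> L * dist x y" for x y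
  proof -
    have "dist (F x) (F y) \<le> L * dist (closest_point (cball y0 r) x) (closest_point (cball y0 r) y)"
      unfolding F_def by (rule lipschitz_onD[OF L cp cp])
    also have "\<dots> \<le> L * dist x y"
      using r L0 by (intro mult_left_mono closest_point_lipschitz) auto
    finally show ?thesis .
  qed
  have LF: "L-lipschitz_on UNIV F" using dF L0 by (intro lipschitz_onI) auto
  have "compact (f ` cball y0 r)"
    by (intro compact_continuous_image lipschitz_on_continuous_on[OF L] compact_cball)
  then obtain M where M: "0 < M" "\<And>x. norm (F x) \<le> M"
    using compact_imp_bounded[THEN bounded_pos[THEN iffD1]] cp unfolding F_def by (metis imageI)
  \<comment> \<open>The first bound keeps the solution in the ball; the second is for the contraction factor 1/2.\<close>
  define e where "e = min (r / M) (1 / (2 * (L + 1)))"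
  have e0: "0 < e" using M r L0 by (simp add: e_def)
  have Me: "M * e \<le> r"
  proof -
    have "M * e \<le> M * (r / M)" unfolding e_def using M by (intro mult_left_mono) auto
    then show ?thesis using M by simp
  qed
  have Le: "L * e \<le> 1 / 2"
  proof -
    have "L * e \<le> L * (1 / (2 * (L + 1)))" unfolding e_def using L0 by (intro mult_left_mono) auto
    also have "\<dots> \<le> 1 / 2" using L0 by (simp add: field_simps)
    finally show ?thesis .
  qed
  define c where "c t = max (- e) (min e t)" for t
  have c: "- e \<le> c t" "\<bar>c t\<bar> \<le> e" for t using e0 by (auto simp: c_def)
  have cc: "continuous_on UNIV c" unfolding c_def by (intro continuous_intros)
  define I where "I h t = integral {-e..t} h - integral {-e..0} h" for h :: "real \<Rightarrow> 'a" and t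
  have Ider: "(I h has_vector_derivative h t) (at t)"
    if "continuous_on UNIV h" "t \<in> {-e<..<e}" for h t
  proof -
    have "((\<lambda>t. integral {-e..t} h) has_vector_derivative h t) (at t within {-e..e})"
      using that by (intro integral_has_vector_derivative continuous_on_subset[OF that(1)]) auto
    moreover have "at t within {-e..e} = at t"
      using that(2) by (intro at_within_interior) auto
    ultimately show ?thesis
      unfolding I_def by (auto intro!: derivative_eq_intros)
  qed
  have Icont: "continuous_on {-e..e} (I h)" if "continuous_on UNIV h" for h
    unfolding I_def
    by (intro continuous_intros indefinite_integral_continuous_1 integrable_continuous_real
        continuous_on_subset[OF that]) auto
  have Ib: "norm (I h (c t)) \<le> B * e" if "continuous_on UNIV h" "\<And>s. norm (h s) \<le> B" for h B t
  proof -
    have "norm (I h (c t)) \<le> B * \<bar>c t\<bar>"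
      using norm_integral_diff_le[OF that, of "-e" 0 "c t"] c e0 unfolding I_def by simp
    also have "\<dots> \<le> B * e"
      using c(2)[of t] norm_ge_zero[of "h 0"] that(2)[of 0] by (intro mult_left_mono) linarith+
    finally show ?thesis .
  qed
  have Fc: "continuous_on UNIV (\<lambda>s. F (apply_bcontfun u s))" for u :: "real \<Rightarrow>\<^sub>C 'a"
    by (intro continuous_on_compose2[OF lipschitz_on_continuous_on[OF LF]]) auto
  define S where "S u t = y0 + I (\<lambda>s. F (apply_bcontfun u s)) (c t)" for u :: "real \<Rightarrow>\<^sub>C 'a" and t
  have Sy0: "norm (S u t - y0) \<le> M * e" for u t
    unfolding S_def using Ib[OF Fc M(2), of u t] by simp
  have S: "S u \<in> bcontfun" for u
  proof (rule bcontfun_normI)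
    show "continuous_on UNIV (S u)"
      unfolding S_def using c
      by (intro continuous_intros continuous_on_compose2[OF Icont[OF Fc] cc]) (auto simp: abs_le_iff)
    show "norm (S u t) \<le> norm y0 + M * e" for t
      using Sy0[of u t] norm_triangle_sub[of "S u t" y0] by linarith
  qed
  have app: "apply_bcontfun (Bcontfun (S u)) = S u" for u
    using S by (simp add: Bcontfun_inverse)
  have "\<exists>!u. Bcontfun (S u) = u"
  proof (rule banach_fix_type)
    show "\<forall>u v. dist (Bcontfun (S u)) (Bcontfun (S v)) \<le> 1 / 2 * dist u v"
    proof (intro allI dist_bound)
      fix u v :: "real \<Rightarrow>\<^sub>C 'a" and t
      have int: "(\<lambda>s. F (apply_bcontfun w s)) integrable_on {x..y}" for w x and y :: real
        by (intro integrable_continuous_real continuous_on_subset[OF Fc]) auto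
      have "S u t - S v t = I (\<lambda>s. F (apply_bcontfun u s) - F (apply_bcontfun v s)) (c t)"
        unfolding S_def I_def using int by (simp add: Henstock_Kurzweil_Integration.integral_diff)
      also have "norm \<dots> \<le> (L * dist u v) * e"
      proof (rule Ib)
        show "continuous_on UNIV (\<lambda>s. F (apply_bcontfun u s) - F (apply_bcontfun v s))"
          by (intro continuous_intros Fc)
        show "norm (F (apply_bcontfun u s) - F (apply_bcontfun v s)) \<le> L * dist u v" for s
          using dF[of "u s" "v s"] mult_left_mono[OF dist_bounded[of u s v] L0]
          by (simp add: dist_norm)
      qed
      also have "\<dots> = (L * e) * dist u v" by simp
      also have "\<dots> \<le> 1 / 2 * dist u v" using Le by (intro mult_right_mono) auto
      finally show "dist (apply_bcontfun (Bcontfun (S u)) t) (apply_bcontfun (Bcontfun (S v)) t)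
          \<le> 1 / 2 * dist u v"
        by (simp add: app dist_norm)
    qed
  qed auto
  then obtain u where u: "Bcontfun (S u) = u" by auto
  have uS: "apply_bcontfun u = S u" using app[of u] u by simp
  have ball: "u t \<in> cball y0 r" for t
    using Sy0[of u t] Me by (simp add: uS dist_norm norm_minus_commute)
  have Fu: "F (u t) = f (u t)" for t
    using ball[of t] by (simp add: F_def closest_point_self)
  show thesis
  proof (rule that[OF e0, of "apply_bcontfun u"])
    show "u 0 = y0" using e0 unfolding uS by (simp add: S_def c_def I_def)
    show "u t \<in> cball y0 r" for t by (rule ball)
    show "(u has_vector_derivative f (u t)) (at t)" if t: "t \<in> {-e<..<e}" for t
    proof -
      have "((\<lambda>t. y0 + I (\<lambda>s. F (apply_bcontfun u s)) t) has_vector_derivative F (u t)) (at t)"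
        using Ider[OF Fc t] by (auto intro!: derivative_eq_intros)
      then have "(S u has_vector_derivative F (u t)) (at t)"
        by (rule has_vector_derivative_transform_within_open[OF _ open_greaterThanLessThan t])
          (auto simp: S_def c_def)
      then show ?thesis by (simp add: uS[symmetric] Fu)
    qed
  qed
qed

section \<open>Functions that are Lipschitz near a point\<close>

definition lipschitz_near :: "('a::metric_space \<Rightarrow> 'b::metric_space) \<Rightarrow> 'a \<Rightarrow> bool" where
  "lipschitz_near f x \<longleftrightarrow> (\<exists>r>0. \<exists>L. L-lipschitz_on (ball x r) f)"

lemma lipschitz_near_const: "lipschitz_near (\<lambda>y. c) x"
  unfolding lipschitz_near_def using lipschitz_on_constant zero_less_one by blast

lemma lipschitz_near_common_ball:
  assumes "lipschitz_near f x" "lipschitz_near g x"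
  obtains r L M where "0 < r" "L-lipschitz_on (ball x r) f" "M-lipschitz_on (ball x r) g"
proof -
  from assms obtain r L s M where "0 < r" "L-lipschitz_on (ball x r) f"
    and "0 < s" "M-lipschitz_on (ball x s) g" unfolding lipschitz_near_def by blast
  then show thesis
    by (intro that[of "min r s" L M]) (auto elim!: lipschitz_on_subset)
qed

lemma lipschitz_near_transform:
  assumes f: "lipschitz_near f x" and U: "open U" "x \<in> U" "\<And>y. y \<in> U \<Longrightarrow> f y = g y"
  shows "lipschitz_near g x"
proof -
  obtain r L where r: "0 < r" "L-lipschitz_on (ball x r) f" using f unfolding lipschitz_near_def by blast
  obtain s where s: "0 < s" "ball x s \<subseteq> U" using U(1,2) open_contains_ball by blast
  have "L-lipschitz_on (ball x (min r s)) g"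
    by (rule lipschitz_on_transform[OF lipschitz_on_subset[OF r(2)]]) (use s U(3) in auto)
  then show ?thesis unfolding lipschitz_near_def using r s by (intro exI[of _ "min r s"]) auto
qed

lemma lipschitz_near_compose_nonexpansive:
  assumes f: "lipschitz_near f (p x)" and p: "\<And>y z. dist (p y) (p z) \<le> dist y z"
  shows "lipschitz_near (\<lambda>y. f (p y)) x"
proof -
  obtain r L where r: "0 < r" "L-lipschitz_on (ball (p x) r) f" using f unfolding lipschitz_near_def by blast
  have "p ` ball x r \<subseteq> ball (p x) r"
  proof safe
    fix y assume "y \<in> ball x r"
    then show "p y \<in> ball (p x) r" using p[of x y] by simp
  qed
  then have "L-lipschitz_on (p ` ball x r) f" by (rule lipschitz_on_subset[OF r(2)])
  moreover have "1-lipschitz_on (ball x r) p" using p by (intro lipschitz_onI) auto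
  ultimately have "(L * 1)-lipschitz_on (ball x r) (\<lambda>y. f (p y))" by (intro lipschitz_on_compose2)
  then show ?thesis using r unfolding lipschitz_near_def by blast
qed

lemma lipschitz_on_ball_bounded:
  fixes f :: "'a::metric_space \<Rightarrow> real"
  assumes "L-lipschitz_on (ball x r) f" "y \<in> ball x r"
  shows "\<bar>f y\<bar> \<le> \<bar>f x\<bar> + L * r"
proof -
  have "0 < r" using assms(2) by (metis ball_eq_empty empty_iff not_le)
  then have "dist (f y) (f x) \<le> L * dist y x" using assms by (intro lipschitz_onD) auto
  also have "\<dots> \<le> L * r" using assms lipschitz_on_nonneg
    by (intro mult_left_mono) (auto simp: dist_commute less_imp_le)
  finally show ?thesis by (simp add: dist_real_def)
qed

lemma lipschitz_near_add:
  fixes f g :: "'a::metric_space \<Rightarrow> real"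
  assumes "lipschitz_near f x" "lipschitz_near g x"
  shows "lipschitz_near (\<lambda>y. f y + g y) x"
  using lipschitz_near_common_ball[OF assms] unfolding lipschitz_near_def
  by (metis lipschitz_on_add)

lemma lipschitz_near_mult:
  fixes f g :: "'a::metric_space \<Rightarrow> real"
  assumes "lipschitz_near f x" "lipschitz_near g x"
  shows "lipschitz_near (\<lambda>y. f y * g y) x"
proof -
  obtain r L M where r: "0 < r" and f: "L-lipschitz_on (ball x r) f" and g: "M-lipschitz_on (ball x r) g"
    using lipschitz_near_common_ball[OF assms] .
  define A where "A = \<bar>f x\<bar> + L * r"
  define B where "B = \<bar>g x\<bar> + M * r"
  have AB: "0 \<le> A" "0 \<le> B" unfolding A_def B_def
    using r lipschitz_on_nonneg[OF f] lipschitz_on_nonneg[OF g] by auto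
  have "(A * M + L * B)-lipschitz_on (ball x r) (\<lambda>y. f y * g y)"
  proof (rule lipschitz_onI)
    fix y z assume yz: "y \<in> ball x r" "z \<in> ball x r"
    have "f y * g y - f z * g z = f y * (g y - g z) + (f y - f z) * g z" by (simp add: algebra_simps)
    also have "\<bar>\<dots>\<bar> \<le> \<bar>f y\<bar> * \<bar>g y - g z\<bar> + \<bar>f y - f z\<bar> * \<bar>g z\<bar>"
      by (metis abs_mult abs_triangle_ineq)
    also have "\<dots> \<le> A * (M * dist y z) + (L * dist y z) * B"
      using lipschitz_on_ball_bounded[OF f yz(1)] lipschitz_on_ball_bounded[OF g yz(2)]
        lipschitz_onD[OF f yz] lipschitz_onD[OF g yz] AB lipschitz_on_nonneg[OF f]
      unfolding A_def[symmetric] B_def[symmetric]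
      by (intro add_mono mult_mono) (auto simp: dist_real_def)
    finally show "dist (f y * g y) (f z * g z) \<le> (A * M + L * B) * dist y z"
      by (simp add: dist_real_def algebra_simps)
  qed (use AB lipschitz_on_nonneg[OF f] lipschitz_on_nonneg[OF g] in auto)
  then show ?thesis unfolding lipschitz_near_def using r by blast
qed

text \<open>
  On a ball where \<open>f\<close> varies by at most \<open>m = \<bar>f x\<bar> / 2\<close>, the value \<open>\<bar>f\<bar>\<close> is at least \<open>m\<close>, and
  \<open>1/f(y) - 1/f(z) = (f(z) - f(y)) / (f(y) f(z))\<close> costs only the factor \<open>1/m\<^sup>2\<close>.
\<close>

lemma lipschitz_near_inverse:
  fixes f :: "'a::metric_space \<Rightarrow> real"
  assumes f: "lipschitz_near f x" and nz: "f x \<noteq> 0"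
  shows "lipschitz_near (\<lambda>y. inverse (f y)) x"
proof -
  obtain r L where r: "0 < r" and L: "L-lipschitz_on (ball x r) f" using f unfolding lipschitz_near_def by blast
  have L0: "0 \<le> L" using L by (rule lipschitz_on_nonneg)
  define m where "m = \<bar>f x\<bar> / 2"
  have m: "0 < m" using nz by (simp add: m_def)
  define s where "s = min r (m / (L + 1))"
  have s: "0 < s" "s \<le> r" using r m L0 by (auto simp: s_def)
  have "L * s \<le> L * (m / (L + 1))" using L0 by (intro mult_left_mono) (auto simp: s_def)
  also have "\<dots> \<le> m" using L0 m by (simp add: field_simps)
  finally have Ls: "L * s \<le> m" .
  have low: "m \<le> \<bar>f y\<bar>" if "y \<in> ball x s" for y
  proof -
    have "dist (f x) (f y) \<le> L * dist x y" using that s by (intro lipschitz_onD[OF L]) auto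
    also have "\<dots> \<le> L * s" using that L0 by (intro mult_left_mono) auto
    finally show ?thesis using Ls by (simp add: dist_real_def m_def)
  qed
  have "(L / (m * m))-lipschitz_on (ball x s) (\<lambda>y. inverse (f y))"
  proof (rule lipschitz_onI)
    fix y z assume yz: "y \<in> ball x s" "z \<in> ball x s"
    have nz: "f y \<noteq> 0" "f z \<noteq> 0" using low yz m by fastforce+
    have "\<bar>inverse (f y) - inverse (f z)\<bar> = \<bar>f z - f y\<bar> / (\<bar>f y\<bar> * \<bar>f z\<bar>)"
    proof -
      have "inverse (f y) - inverse (f z) = (f z - f y) / (f y * f z)" using nz by (simp add: field_simps)
      then show ?thesis by (simp add: abs_mult)
    qed
    also have "\<dots> \<le> (L * dist y z) / (m * m)"
      using low[OF yz(1)] low[OF yz(2)] m L0 lipschitz_onD[OF L, of y z] yz s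
      by (intro frac_le mult_mono) (auto simp: dist_real_def abs_minus_commute)
    finally show "dist (inverse (f y)) (inverse (f z)) \<le> L / (m * m) * dist y z"
      by (simp add: dist_real_def)
  qed (use L0 m in auto)
  then show ?thesis unfolding lipschitz_near_def using s by blast
qed

lemma lipschitz_near_sum:
  fixes f :: "'i \<Rightarrow> 'a::metric_space \<Rightarrow> real"
  assumes "\<And>i. i \<in> I \<Longrightarrow> lipschitz_near (f i) x"
  shows "lipschitz_near (\<lambda>y. \<Sum>i\<in>I. f i y) x"
  using assms
  by (induction I rule: infinite_finite_induct) (auto intro: lipschitz_near_const lipschitz_near_add)

lemma lipschitz_near_prod:
  fixes f :: "'i \<Rightarrow> 'a::metric_space \<Rightarrow> real"
  assumes "\<And>i. i \<in> I \<Longrightarrow> lipschitz_near (f i) x"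
  shows "lipschitz_near (\<lambda>y. \<Prod>i\<in>I. f i y) x"
  using assms
  by (induction I rule: infinite_finite_induct) (auto intro: lipschitz_near_const lipschitz_near_mult)

lemma lipschitz_near_cmult:
  fixes f :: "'a::metric_space \<Rightarrow> real"
  shows "lipschitz_near f x \<Longrightarrow> lipschitz_near (\<lambda>y. c * f y) x"
  by (intro lipschitz_near_mult lipschitz_near_const)

lemma lipschitz_near_det:
  fixes M :: "'a::metric_space \<Rightarrow> real ^ 'n ^ 'n"
  assumes "\<And>i j. lipschitz_near (\<lambda>y. M y $ i $ j) x"
  shows "lipschitz_near (\<lambda>y. det (M y)) x"
  unfolding det_def
  by (intro lipschitz_near_sum lipschitz_near_cmult lipschitz_near_prod assms)

lemma matrix_inv_mult:
  fixes A :: "real ^ 'n ^ 'n"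
  assumes "det A \<noteq> 0"
  shows "A ** matrix_inv A = mat 1" "matrix_inv A ** A = mat 1"
proof -
  have "\<exists>B. A ** B = mat 1 \<and> B ** A = mat 1"
    using assms invertible_det_nz[of A] unfolding invertible_def by blast
  then have "A ** matrix_inv A = mat 1 \<and> matrix_inv A ** A = mat 1"
    unfolding matrix_inv_def by (rule someI_ex)
  then show "A ** matrix_inv A = mat 1" "matrix_inv A ** A = mat 1" by auto
qed

text \<open>
  Cramer's rule, in the form that exhibits the entries of the inverse as rational functions of the
  entries of \<open>A\<close>.
\<close>

lemma matrix_inv_eq_cofactor_quotient:
  fixes A :: "real ^ 'n ^ 'n"
  assumes "det A \<noteq> 0"
  shows "matrix_inv A $ i $ j
    = det (\<chi> k l. if l = i then axis j 1 $ k else A $ k $ l) * inverse (det A)"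
proof -
  have "A *v (matrix_inv A *v axis j 1) = axis j 1"
    by (simp add: matrix_vector_mul_assoc matrix_inv_mult[OF assms])
  then have "matrix_inv A *v axis j 1
      = (\<chi> k. det (\<chi> m l. if l = k then axis j 1 $ m else A $ m $ l) / det A)"
    using cramer[OF assms] by blast
  then have "(matrix_inv A *v axis j 1) $ i
      = det (\<chi> m l. if l = i then axis j 1 $ m else A $ m $ l) / det A" by simp
  then show ?thesis
    by (simp add: matrix_vector_mult_basis column_def divide_inverse)
qed

lemma lipschitz_near_matrix_inv:
  fixes M :: "'a::metric_space \<Rightarrow> real ^ 'n ^ 'n"
  assumes M: "\<And>i j. lipschitz_near (\<lambda>y. M y $ i $ j) x"
    and U: "open U" "x \<in> U" "\<And>y. y \<in> U \<Longrightarrow> det (M y) \<noteq> 0"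
  shows "lipschitz_near (\<lambda>y. matrix_inv (M y) $ i $ j) x"
proof -
  have "lipschitz_near (\<lambda>y. det (\<chi> k l. if l = i then axis j 1 $ k else M y $ k $ l)
      * inverse (det (M y))) x"
  proof (intro lipschitz_near_mult lipschitz_near_inverse lipschitz_near_det M)
    show "lipschitz_near (\<lambda>y. (\<chi> k l. if l = i then axis j 1 $ k else M y $ k $ l) $ k $ l) x" for k l
      by (cases "l = i") (auto intro: lipschitz_near_const M)
  qed (use U in auto)
  then show ?thesis
    by (rule lipschitz_near_transform[OF _ U(1,2)])
      (simp add: matrix_inv_eq_cofactor_quotient[OF U(3)])
qed

lemma has_derivative_pdiff:
  fixes f :: "real ^ 'n::finite \<Rightarrow> real"
  assumes "f differentiable at x"
  shows "(f has_derivative (\<lambda>v. \<Sum>k\<in>UNIV. v $ k * pdiff k f x)) (at x)"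
proof -
  let ?D = "frechet_derivative f (at x)"
  have lin: "linear ?D" using assms by (rule linear_frechet_derivative)
  have "?D = (\<lambda>v. \<Sum>k\<in>UNIV. v $ k * pdiff k f x)"
  proof
    fix v :: "real ^ 'n"
    have "?D v = ?D (\<Sum>k\<in>UNIV. v $ k *\<^sub>R axis k 1)"
      by (simp add: basis_expansion scalar_mult_eq_scaleR[symmetric])
    also have "\<dots> = (\<Sum>k\<in>UNIV. v $ k * pdiff k f x)"
      by (simp add: linear_sum[OF lin] linear_scale[OF lin] pdiff_def)
    finally show "?D v = (\<Sum>k\<in>UNIV. v $ k * pdiff k f x)" .
  qed
  then show ?thesis using frechet_derivative_works assms by metis
qed

lemma pdiff_eqI:
  assumes "(f has_derivative D) (at x)" shows "pdiff k f x = D (axis k 1)"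
  unfolding pdiff_def using frechet_derivative_at[OF assms] by simp

text \<open>
  On a compact ball the continuous partial derivatives are bounded, and the mean value inequality
  applies.
\<close>

lemma C_diff_lipschitz_near:
  fixes f :: "real ^ 'n::finite \<Rightarrow> real"
  assumes U: "open U" "x \<in> U" and f: "C_diff (Suc 0) U f"
  shows "lipschitz_near f x"
proof -
  obtain r where r: "0 < r" "cball x r \<subseteq> U" using U open_contains_cball by blast
  have "\<exists>B. \<forall>y\<in>cball x r. \<bar>pdiff k f y\<bar> \<le> B" for k
  proof -
    have "continuous_on (cball x r) (pdiff k f)"
      using f r by (auto intro: continuous_on_subset)
    then have "bounded (pdiff k f ` cball x r)"
      by (intro compact_imp_bounded compact_continuous_image) auto
    then show ?thesis by (auto simp: bounded_iff)
  qed
  then obtain B where B: "\<And>k y. y \<in> cball x r \<Longrightarrow> \<bar>pdiff k f y\<bar> \<le> B k" by metis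
  have "(\<Sum>k\<in>UNIV. B k)-lipschitz_on (ball x r) f"
  proof (rule bounded_derivative_imp_lipschitz)
    fix y assume y: "y \<in> ball x r"
    then have "y \<in> U" using r by auto
    then have "f differentiable at y" using f U(1)
      by (metis C_diff.simps(2) differentiable_on_eq_differentiable_at)
    then show "(f has_derivative (\<lambda>v. \<Sum>k\<in>UNIV. v $ k * pdiff k f y)) (at y within ball x r)"
      by (rule has_derivative_at_withinI[OF has_derivative_pdiff])
    show "onorm (\<lambda>v. \<Sum>k\<in>UNIV. v $ k * pdiff k f y) \<le> (\<Sum>k\<in>UNIV. B k)"
    proof (rule onorm_le)
      fix v :: "real ^ 'n"
      have "norm (\<Sum>k\<in>UNIV. v $ k * pdiff k f y) \<le> (\<Sum>k\<in>UNIV. norm v * B k)"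
      proof (rule sum_norm_le)
        fix k
        have "\<bar>v $ k\<bar> * \<bar>pdiff k f y\<bar> \<le> norm v * B k"
          using y B[of y k] by (intro mult_mono component_le_norm_cart) auto
        then show "norm (v $ k * pdiff k f y) \<le> norm v * B k" by (simp add: abs_mult)
      qed
      then show "norm (\<Sum>k\<in>UNIV. v $ k * pdiff k f y) \<le> (\<Sum>k\<in>UNIV. B k) * norm v"
        by (simp add: sum_distrib_left mult.commute)
    qed
  next
    show "0 \<le> (\<Sum>k\<in>UNIV. B k)"
      using B[of x] r by (intro sum_nonneg) (metis abs_ge_zero centre_in_cball less_imp_le order_trans)
  qed auto
  then show ?thesis using r unfolding lipschitz_near_def by blast
qed

section \<open>Existence of geodesics\<close>

lemma lipschitz_near_Gamma:
  assumes g: "gen_Riemannian U g" and x: "x \<in> U"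
  shows "lipschitz_near (\<lambda>y. Gamma g y i j k) x"
proof -
  have U: "open U" using g by (simp add: gen_Riemannian_def)
  have C: "C_diff m U (\<lambda>x. g x $ i $ j)" for m i j
    using g by (simp add: gen_Riemannian_def smooth_field2_def)
  have g0: "lipschitz_near (\<lambda>x. g x $ i $ j) x" for i j
    by (rule C_diff_lipschitz_near[OF U x C])
  have g1: "lipschitz_near (\<lambda>y. pdiff k (\<lambda>x. g x $ i $ j) y) x" for i j k
    using C_diff_lipschitz_near[OF U x, of "pdiff k (\<lambda>x. g x $ i $ j)"] C[of "Suc (Suc 0)" i j]
    by simp
  have inv: "lipschitz_near (\<lambda>y. matrix_inv (sym_part (g y)) $ i $ p) x" for p
  proof (rule lipschitz_near_matrix_inv[OF _ U x])
    show "lipschitz_near (\<lambda>y. sym_part (g y) $ i $ j) x" for i j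
      using lipschitz_near_cmult[OF lipschitz_near_add[OF g0[of i j] g0[of j i]], of "1/2"]
      by (simp add: sym_part_def)
  qed (use g in \<open>auto simp: gen_Riemannian_def\<close>)
  have low: "lipschitz_near (\<lambda>y. Gamma_low g y p j k) x" for p
    using lipschitz_near_cmult[OF lipschitz_near_add[OF lipschitz_near_add[OF g1[of k j p]
        lipschitz_near_cmult[OF g1[of p j k], of "-1"]] g1[of j p k]], of "1/2"]
    by (simp add: Gamma_low_def)
  show ?thesis
    unfolding Gamma_def by (intro lipschitz_near_sum lipschitz_near_mult inv low)
qed

lemma lipschitz_near_vec:
  fixes f :: "'a::metric_space \<Rightarrow> real ^ 'n::finite"
  assumes "\<And>i. lipschitz_near (\<lambda>y. f y $ i) x"
  shows "lipschitz_near f x"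
proof -
  from assms obtain r L where r: "\<And>i. 0 < r i" and L: "\<And>i. (L i)-lipschitz_on (ball x (r i)) (\<lambda>y. f y $ i)"
    unfolding lipschitz_near_def by metis
  define s where "s = Min (range r)"
  have s: "0 < s" "\<And>i. s \<le> r i" using r by (auto simp: s_def)
  have "(\<Sum>i\<in>UNIV. L i)-lipschitz_on (ball x s) f"
  proof (rule lipschitz_onI)
    fix y z assume yz: "y \<in> ball x s" "z \<in> ball x s"
    have "dist (f y) (f z) \<le> (\<Sum>i\<in>UNIV. dist (f y $ i) (f z $ i))"
      unfolding dist_vec_def by (rule L2_set_le_sum) auto
    also have "\<dots> \<le> (\<Sum>i\<in>UNIV. L i * dist y z)"
    proof (rule sum_mono)
      fix i show "dist (f y $ i) (f z $ i) \<le> L i * dist y z"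
        using yz s(2)[of i] by (intro lipschitz_onD[OF L]) auto
    qed
    finally show "dist (f y) (f z) \<le> (\<Sum>i\<in>UNIV. L i) * dist y z" by (simp add: sum_distrib_right)
  qed (use L in \<open>auto intro: sum_nonneg lipschitz_on_nonneg\<close>)
  then show ?thesis using s unfolding lipschitz_near_def by blast
qed

lemma lipschitz_near_Pair:
  assumes "lipschitz_near f x" "lipschitz_near g x"
  shows "lipschitz_near (\<lambda>y. (f y, g y)) x"
  using lipschitz_near_common_ball[OF assms] unfolding lipschitz_near_def
  by (metis lipschitz_on_Pair)

lemma lipschitz_near_id: "lipschitz_near (\<lambda>y. y) x"
  unfolding lipschitz_near_def using lipschitz_on_id zero_less_one by blast

text \<open>
  The equation \<open>\<gamma>'' = - \<Gamma>(\<gamma>', \<gamma>')\<close> is read as a first-order system for the pair (position, velocity).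
  The radius of the ball around \<open>(x, v)\<close> in which it is solved is so small that the ball of
  this radius around \<open>x\<close> lies in \<open>U\<close>, and smaller than \<open>norm v\<close>: the curve stays in \<open>U\<close> and is
  regular. The parameter obtained is affine, so the factor of proportionality is zero.
\<close>

lemma geodesic_through_point_and_direction:
  fixes g :: "real ^ 'n::finite \<Rightarrow> real ^ 'n ^ 'n"
  assumes g: "gen_Riemannian U g" and x: "x \<in> U" and v: "v \<noteq> 0"
  obtains J \<gamma> w a where "geodesic U g J \<gamma>" "0 \<in> J" "\<gamma> 0 = x" "w 0 = v"
    "\<And>t. t \<in> J \<Longrightarrow> (\<gamma> has_vector_derivative w t) (at t)"
    "(w has_vector_derivative a) (at 0)"
    "\<And>i. a $ i = - (\<Sum>j\<in>UNIV. \<Sum>k\<in>UNIV. Gamma g x i j k * v $ j * v $ k)"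
proof -
  define A where "A z = (\<chi> i. - (\<Sum>j\<in>UNIV. \<Sum>k\<in>UNIV. Gamma g (fst z) i j k * snd z $ j * snd z $ k))"
    for z :: "(real ^ 'n) \<times> (real ^ 'n)"
  have lip: "lipschitz_near (\<lambda>z. (snd z, A z)) (x, v)"
  proof (intro lipschitz_near_Pair lipschitz_near_vec)
    have cmp: "lipschitz_near (\<lambda>z. snd z $ j) (x, v)" for j :: 'n
    proof (rule lipschitz_near_compose_nonexpansive[where f = "\<lambda>y. y" and p = "\<lambda>z. snd z $ j", OF lipschitz_near_id])
      show "dist (snd y $ j) (snd z $ j) \<le> dist y z" for y z :: "(real ^ 'n) \<times> (real ^ 'n)"
        using dist_vec_nth_le[of "snd y" j "snd z"] dist_snd_le[of y z] by linarith
    qed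
    show "lipschitz_near (\<lambda>z. snd z $ j) (x, v)" for j :: 'n by (rule cmp)
    have Gam: "lipschitz_near (\<lambda>z. Gamma g (fst z) i j k) (x, v)" for i j k
      by (rule lipschitz_near_compose_nonexpansive[where p = fst])
        (auto intro: lipschitz_near_Gamma[OF g x] dist_fst_le)
    have "lipschitz_near (\<lambda>z. -1 * (\<Sum>j\<in>UNIV. \<Sum>k\<in>UNIV. Gamma g (fst z) i j k * snd z $ j * snd z $ k)) (x, v)" for i
      by (intro lipschitz_near_cmult lipschitz_near_sum lipschitz_near_mult cmp Gam)
    then show "lipschitz_near (\<lambda>z. A z $ i) (x, v)" for i by (simp add: A_def)
  qed
  then obtain r L where r: "0 < r" and L: "L-lipschitz_on (ball (x, v) r) (\<lambda>z. (snd z, A z))"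
    unfolding lipschitz_near_def by blast
  obtain s where s: "0 < s" "ball x s \<subseteq> U" using g x unfolding gen_Riemannian_def open_contains_ball by blast
  define q where "q = min r (min s (norm v)) / 2"
  have q: "0 < q" "q < r" "q < s" "q < norm v"
    unfolding q_def using r s(1) zero_less_norm_iff[THEN iffD2, OF v] by linarith+
  have Lq: "L-lipschitz_on (cball (x, v) q) (\<lambda>z. (snd z, A z))"
    using q by (intro lipschitz_on_subset[OF L]) auto
  obtain e u where e: "0 < e" and u0: "u 0 = (x, v)"
    and uq: "\<And>t. t \<in> {-e<..<e} \<Longrightarrow> u t \<in> cball (x, v) q"
    and ud: "\<And>t. t \<in> {-e<..<e} \<Longrightarrow> (u has_vector_derivative (snd (u t), A (u t))) (at t)"
    using Picard_local_existence[OF q(1) Lq] by blast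
  define J where "J = {-e<..<e}"
  have d1: "((\<lambda>t. fst (u t)) has_vector_derivative snd (u t)) (at t)" if "t \<in> J" for t
    using bounded_linear.has_vector_derivative[OF bounded_linear_fst ud] that by (simp add: J_def)
  have d2: "((\<lambda>t. snd (u t)) has_vector_derivative A (u t)) (at t)" if "t \<in> J" for t
    using bounded_linear.has_vector_derivative[OF bounded_linear_snd ud] that by (simp add: J_def)
  have "continuous_on J u"
    using ud unfolding J_def
    by (meson continuous_at_imp_continuous_on has_vector_derivative_continuous)
  then have "continuous_on J (\<lambda>t. (snd (u t), A (u t)))"
    using uq by (intro continuous_on_compose2[OF lipschitz_on_continuous_on[OF Lq]]) (auto simp: J_def)
  then have cA: "continuous_on J (\<lambda>t. A (u t))" using continuous_on_snd by fastforce
  have inU: "fst (u t) \<in> U" if "t \<in> J" for t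
    using uq[of t] that q s dist_fst_le[of "(x, v)" "u t"] by (force simp: J_def)
  have nz: "snd (u t) \<noteq> 0" if "t \<in> J" for t
    using uq[of t] that q dist_snd_le[of "(x, v)" "u t"] by (auto simp: J_def)
  have geo: "geodesic U g J (\<lambda>t. fst (u t))"
    unfolding geodesic_def
  proof (intro conjI exI ballI allI)
    show "J \<noteq> {}" using e by (auto simp: J_def)
    show "A (u t) $ i + (\<Sum>j\<in>UNIV. \<Sum>k\<in>UNIV. Gamma g (fst (u t)) i j k * snd (u t) $ j * snd (u t) $ k)
        = (\<lambda>t. 0) t * snd (u t) $ i" for t i
      by (simp add: A_def)
  qed (use inU nz d1 d2 cA in \<open>auto simp: J_def is_interval_oo\<close>)
  have J0: "0 \<in> J" using e by (simp add: J_def)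
  have A0: "A (u 0) $ i = - (\<Sum>j\<in>UNIV. \<Sum>k\<in>UNIV. Gamma g x i j k * v $ j * v $ k)" for i
    by (simp add: A_def u0)
  show thesis
    by (rule that[OF geo J0 _ _ d1 d2[OF J0] A0]) (simp_all add: u0)
qed

section \<open>Connection coefficients, metric and torsion\<close>

lemma sym_part_sym: "sym_part A $ i $ j = sym_part A $ j $ i"
  by (simp add: sym_part_def)

lemma sym_part_add_alt_part: "A $ i $ j = sym_part A $ i $ j + alt_part A $ i $ j"
  by (simp add: sym_part_def alt_part_def field_simps)

lemma matrix_inv_sym:
  fixes A :: "real ^ 'n ^ 'n"
  assumes "det A \<noteq> 0" "\<And>i j. A $ i $ j = A $ j $ i"
  shows "matrix_inv A $ i $ j = matrix_inv A $ j $ i"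
proof -
  let ?B = "matrix_inv A"
  have A: "transpose A = A" using assms(2) by (simp add: transpose_def vec_eq_iff)
  have "transpose ?B ** A = mat 1"
    using matrix_inv_mult(1)[OF assms(1)] by (metis A matrix_transpose_mul transpose_mat)
  then have "transpose ?B = ?B"
    using matrix_inv_mult(1)[OF assms(1)] by (metis matrix_mul_assoc matrix_mul_lid matrix_mul_rid)
  then show ?thesis by (simp add: transpose_def vec_eq_iff)
qed

lemma matrix_inv_contract:
  fixes A :: "real ^ 'n ^ 'n"
  assumes "det A \<noteq> 0"
  shows "(\<Sum>p\<in>UNIV. A $ i $ p * (\<Sum>q\<in>UNIV. matrix_inv A $ p $ q * f q)) = f i"
    and "(\<Sum>p\<in>UNIV. matrix_inv A $ i $ p * (\<Sum>q\<in>UNIV. A $ p $ q * f q)) = f i"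
proof -
  have "A *v (matrix_inv A *v (\<chi> q. f q)) = (\<chi> q. f q)" "matrix_inv A *v (A *v (\<chi> q. f q)) = (\<chi> q. f q)"
    by (simp_all add: matrix_vector_mul_assoc matrix_inv_mult[OF assms])
  then show "(\<Sum>p\<in>UNIV. A $ i $ p * (\<Sum>q\<in>UNIV. matrix_inv A $ p $ q * f q)) = f i"
    and "(\<Sum>p\<in>UNIV. matrix_inv A $ i $ p * (\<Sum>q\<in>UNIV. A $ p $ q * f q)) = f i"
    by (simp_all add: matrix_vector_mult_def vec_eq_iff)
qed

lemma lower_Gamma:
  assumes "det (sym_part (g x)) \<noteq> 0"
  shows "(\<Sum>p\<in>UNIV. sym_part (g x) $ i $ p * Gamma g x p j k) = Gamma_low g x i j k"
  unfolding Gamma_def using matrix_inv_contract(1)[OF assms] .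

lemma symmetric_alternating_contraction:
  fixes S T :: "'n::finite \<Rightarrow> 'n \<Rightarrow> real"
  assumes "\<And>a b. S a b = S b a" "\<And>a b. T a b = - T b a"
  shows "(\<Sum>a\<in>UNIV. \<Sum>b\<in>UNIV. S a b * T a b) = 0"
proof -
  have "(\<Sum>a\<in>UNIV. \<Sum>b\<in>UNIV. S a b * T a b) = (\<Sum>b\<in>UNIV. \<Sum>a\<in>UNIV. S a b * T a b)"
    by (rule sum.swap)
  also have "\<dots> = (\<Sum>b\<in>UNIV. \<Sum>a\<in>UNIV. - (S b a * T b a))"
    by (intro sum.cong refl) (metis assms mult_minus_right)
  also have "\<dots> = - (\<Sum>a\<in>UNIV. \<Sum>b\<in>UNIV. S a b * T a b)" by (simp add: sum_negf)
  finally show ?thesis by simp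
qed

text \<open>
  The part of \<open>\<Gamma>_p.jk\<close> antisymmetric in \<open>j, k\<close> is half the cyclic sum of the derivatives of the
  antisymmetric part of \<open>g\<close>, up to sign. It is antisymmetric in \<open>p, k\<close> too, and is therefore killed
  by the contraction with the symmetric inverse metric.
\<close>

lemma Gamma_trace_sym:
  assumes "det (sym_part (g x)) \<noteq> 0"
  shows "(\<Sum>\<alpha>\<in>UNIV. Gamma g x \<alpha> i \<alpha>) = (\<Sum>\<alpha>\<in>UNIV. Gamma g x \<alpha> \<alpha> i)"
proof -
  have "(\<Sum>\<alpha>\<in>UNIV. \<Sum>p\<in>UNIV. matrix_inv (sym_part (g x)) $ \<alpha> $ p * (Gamma_low g x p i \<alpha> - Gamma_low g x p \<alpha> i)) = 0"
    by (rule symmetric_alternating_contraction)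
      (auto simp: Gamma_low_def field_simps intro: matrix_inv_sym[OF assms sym_part_sym])
  then show ?thesis by (simp add: Gamma_def algebra_simps sum_subtractf)
qed

lemma xi_trace_zero:
  assumes "det (sym_part (g x)) \<noteq> 0" "det (sym_part (gbar x)) \<noteq> 0"
  shows "(\<Sum>\<alpha>\<in>UNIV. xi g gbar x \<alpha> i \<alpha>) = 0"
  using Gamma_trace_sym[where g = g and x = x, OF assms(1), of i]
    Gamma_trace_sym[where g = gbar and x = x, OF assms(2), of i]
  by (simp add: xi_def deform_def sum_subtractf sum_divide_distrib[symmetric])

lemma pdiff_add:
  assumes "f differentiable at x" "g differentiable at x"
  shows "pdiff k (\<lambda>y. f y + g y) x = pdiff k f x + pdiff k g x"
  by (subst pdiff_eqI[OF has_derivative_add[OF assms[unfolded frechet_derivative_works]]])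
    (simp add: pdiff_def)

lemma pdiff_cmult:
  assumes "f differentiable at x"
  shows "pdiff k (\<lambda>y. c * f y) x = c * pdiff k f x"
  by (subst pdiff_eqI[OF has_derivative_mult_right[OF assms[unfolded frechet_derivative_works]]])
    (simp add: pdiff_def)

lemma pdiff_sym_part:
  assumes "\<And>i j. (\<lambda>y. A y $ i $ j) differentiable at x"
  shows "pdiff k (\<lambda>y. sym_part (A y) $ i $ j) x
    = (pdiff k (\<lambda>y. A y $ i $ j) x + pdiff k (\<lambda>y. A y $ j $ i) x) / 2"
  using pdiff_cmult[of "\<lambda>y. A y $ i $ j + A y $ j $ i" x k "1/2"] assms
  by (simp add: sym_part_def pdiff_add)

lemma pdiff_alt_part:
  assumes "\<And>i j. (\<lambda>y. A y $ i $ j) differentiable at x"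
  shows "pdiff k (\<lambda>y. alt_part (A y) $ i $ j) x
    = (pdiff k (\<lambda>y. A y $ i $ j) x - pdiff k (\<lambda>y. A y $ j $ i) x) / 2"
proof -
  have "pdiff k (\<lambda>y. 1/2 * (A y $ i $ j + (-1) * A y $ j $ i)) x
    = 1/2 * (pdiff k (\<lambda>y. A y $ i $ j) x + (-1) * pdiff k (\<lambda>y. A y $ j $ i) x)"
    using assms
    by (subst pdiff_cmult pdiff_add; (intro differentiable_add differentiable_mult differentiable_const assms)?)+ simp
  then show ?thesis by (simp add: alt_part_def)
qed

text \<open>
  With both indices lowered, the correction terms are \<open>\<Gamma>_j.ki + \<Gamma>_i.kj\<close>, in which everything but
  the derivative of the symmetric part cancels.
\<close>

lemma sym_part_parallel:
  assumes "\<And>i j. (\<lambda>y. g y $ i $ j) differentiable at x" "det (sym_part (g x)) \<noteq> 0"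
  shows "cov3_02 (Gamma g) (\<lambda>y. sym_part (g y)) x i j k = 0"
proof -
  have "(\<Sum>p\<in>UNIV. Gamma g x p k i * sym_part (g x) $ p $ j) = Gamma_low g x j k i"
    using lower_Gamma[where g = g and x = x, OF assms(2), of j k i] by (simp add: mult.commute sym_part_sym[of _ j])
  moreover have "(\<Sum>p\<in>UNIV. Gamma g x p k j * sym_part (g x) $ i $ p) = Gamma_low g x i k j"
    using lower_Gamma[where g = g and x = x, OF assms(2), of i k j] by (simp add: mult.commute)
  ultimately show ?thesis
    by (simp add: cov3_02_def pdiff_sym_part[OF assms(1)] Gamma_low_def field_simps)
qed

lemma cov3_02_deform:
  fixes g gbar :: "'a::finite field2"
  assumes "\<And>i j. (\<lambda>y. gbar y $ i $ j) differentiable at x" "det (sym_part (gbar x)) \<noteq> 0"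
  shows "cov3_02 (Gamma g) gbar x i j k - cov3_02 (Gamma gbar) (\<lambda>y. alt_part (gbar y)) x i j k
    = (\<Sum>p\<in>UNIV. deform g gbar x p k i * gbar x $ p $ j)
      + (\<Sum>p\<in>UNIV. deform g gbar x p k j * gbar x $ i $ p)"
proof -
  have "cov3_02 (Gamma gbar) gbar x i j k
    = cov3_02 (Gamma gbar) (\<lambda>y. sym_part (gbar y)) x i j k
      + cov3_02 (Gamma gbar) (\<lambda>y. alt_part (gbar y)) x i j k"
  proof -
    have "pdiff k (\<lambda>y. gbar y $ i $ j) x
      = pdiff k (\<lambda>y. sym_part (gbar y) $ i $ j) x + pdiff k (\<lambda>y. alt_part (gbar y) $ i $ j) x"
      unfolding pdiff_sym_part[OF assms(1)] pdiff_alt_part[OF assms(1)] by (simp add: field_simps)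
    moreover have "(\<Sum>p\<in>UNIV. C p * gbar x $ a p $ b p)
      = (\<Sum>p\<in>UNIV. C p * sym_part (gbar x) $ a p $ b p) + (\<Sum>p\<in>UNIV. C p * alt_part (gbar x) $ a p $ b p)"
      for C and a b :: "'a \<Rightarrow> 'a"
      unfolding sum.distrib[symmetric] distrib_left[symmetric] sym_part_add_alt_part[symmetric] ..
    note this[of "\<lambda>p. Gamma gbar x p k i" "\<lambda>p. p" "\<lambda>p. j"]
      this[of "\<lambda>p. Gamma gbar x p k j" "\<lambda>p. i" "\<lambda>p. p"]
    ultimately show ?thesis by (simp add: cov3_02_def)
  qed
  moreover have "cov3_02 (Gamma g) gbar x i j k - cov3_02 (Gamma gbar) gbar x i j k
    = (\<Sum>p\<in>UNIV. deform g gbar x p k i * gbar x $ p $ j)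
      + (\<Sum>p\<in>UNIV. deform g gbar x p k j * gbar x $ i $ p)"
    by (simp add: cov3_02_def deform_def left_diff_distrib sum_subtractf)
  ultimately show ?thesis using sym_part_parallel[where g = gbar, OF assms] by simp
qed

lemma cov3_11_deform:
  "cov3_11 (Gamma g) F x h i k - cov3_11 (Gamma gbar) F x h i k
    = (\<Sum>p\<in>UNIV. deform g gbar x p k i * F x $ h $ p) - (\<Sum>p\<in>UNIV. deform g gbar x h p k * F x $ p $ i)"
  by (simp add: cov3_11_def deform_def left_diff_distrib sum_subtractf)

section \<open>The two conditions in terms of the deformation\<close>

text \<open>
  Since \<open>\<psi>\<close> and \<open>\<xi>\<close> are themselves computed from the deformation, and \<open>\<xi>\<close> is its antisymmetric
  part, this restricts the symmetric part only.
\<close>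

definition geodesic_deformation :: "'n::finite field2 \<Rightarrow> 'n field2 \<Rightarrow> real ^ 'n \<Rightarrow> bool" where
  "geodesic_deformation g gbar x \<longleftrightarrow>
     (\<forall>i j k. deform g gbar x i j k
        = (if i = j then psi g gbar x k else 0) + (if i = k then psi g gbar x j else 0) + xi g gbar x i j k)"

text \<open>
  Adding the hypothesis with \<open>i\<close> and \<open>j\<close> exchanged removes the antisymmetric part of \<open>A\<close>: the
  lowered tensor \<open>E_jki\<close> is antisymmetric in \<open>j, i\<close>. It is also symmetric in \<open>k, i\<close>, and alternating
  the two exchanges three times each leads back to \<open>E_jki\<close> with a minus sign.
\<close>

lemma metric_preserving_symmetric_zero:
  fixes D :: "'n::finite \<Rightarrow> 'n \<Rightarrow> 'n \<Rightarrow> real" and A :: "real ^ 'n ^ 'n"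
  assumes sym: "\<And>p k i. D p k i = D p i k"
    and D: "\<And>i j k. (\<Sum>p\<in>UNIV. D p k i * A $ p $ j) + (\<Sum>p\<in>UNIV. D p k j * A $ i $ p) = 0"
    and det: "det (sym_part A) \<noteq> 0"
  shows "D p k i = 0"
proof -
  define E where "E j k i = (\<Sum>p\<in>UNIV. sym_part A $ j $ p * D p k i)" for j k i
  have Es: "E j k i = E j i k" for i j k unfolding E_def by (simp add: sym[of _ k i])
  have Ea: "E j k i = - E i k j" for i j k
  proof -
    have h: "2 * (\<Sum>p\<in>UNIV. sym_part A $ b $ p * d p)
        = (\<Sum>p\<in>UNIV. d p * A $ p $ b) + (\<Sum>p\<in>UNIV. d p * A $ b $ p)" for b d
      unfolding sum_distrib_left sum.distrib[symmetric]
      by (intro sum.cong refl) (simp add: sym_part_def field_simps)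
    have "2 * (E j k i + E i k j)
      = (\<Sum>p\<in>UNIV. D p k i * A $ p $ j) + (\<Sum>p\<in>UNIV. D p k j * A $ i $ p)
        + ((\<Sum>p\<in>UNIV. D p k j * A $ p $ i) + (\<Sum>p\<in>UNIV. D p k i * A $ j $ p))"
      unfolding E_def distrib_left h by simp
    then show ?thesis using D[of k i j] D[of k j i] by simp
  qed
  have E0: "E j k i = 0" for i j k
    using Ea[of j k i] Es[of i k j] Ea[of i j k] Es[of k j i] Ea[of k i j] Es[of j i k] by linarith
  have "D p k i = (\<Sum>q\<in>UNIV. matrix_inv (sym_part A) $ p $ q * E q k i)"
    unfolding E_def using matrix_inv_contract(2)[OF det, of p "\<lambda>p. D p k i"] by simp
  then show ?thesis by (simp add: E0)
qed

lemma metric_condition_iff_geodesic_deformation: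
  assumes "\<And>i j. (\<lambda>y. gbar y $ i $ j) differentiable at x" "det (sym_part (gbar x)) \<noteq> 0"
  shows "(\<forall>i j k. cov3_02 (Gamma g) gbar x i j k =
         cov3_02 (Gamma gbar) (\<lambda>y. alt_part (gbar y)) x i j k
         + 2 * psi g gbar x k * gbar x $ i $ j
         + psi g gbar x i * gbar x $ k $ j + psi g gbar x j * gbar x $ i $ k
         + (\<Sum>\<alpha>\<in>UNIV. xi g gbar x \<alpha> k i * gbar x $ \<alpha> $ j)
         + (\<Sum>\<alpha>\<in>UNIV. xi g gbar x \<alpha> k j * gbar x $ i $ \<alpha>))
    \<longleftrightarrow> geodesic_deformation g gbar x"
proof -
  define D where "D p k i = deform g gbar x p k i - (if p = k then psi g gbar x i else 0)
      - (if p = i then psi g gbar x k else 0) - xi g gbar x p k i" for p k i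
  have sym: "D p k i = D p i k" for p k i by (simp add: D_def xi_def field_simps)
  have *: "(\<Sum>p\<in>UNIV. D p k i * gbar x $ p $ j) + (\<Sum>p\<in>UNIV. D p k j * gbar x $ i $ p)
      = cov3_02 (Gamma g) gbar x i j k - (cov3_02 (Gamma gbar) (\<lambda>y. alt_part (gbar y)) x i j k
         + 2 * psi g gbar x k * gbar x $ i $ j
         + psi g gbar x i * gbar x $ k $ j + psi g gbar x j * gbar x $ i $ k
         + (\<Sum>\<alpha>\<in>UNIV. xi g gbar x \<alpha> k i * gbar x $ \<alpha> $ j)
         + (\<Sum>\<alpha>\<in>UNIV. xi g gbar x \<alpha> k j * gbar x $ i $ \<alpha>))" for i j k
  proof -
    have "(\<Sum>p\<in>UNIV. D p k i * gbar x $ p $ j) = (\<Sum>p\<in>UNIV. deform g gbar x p k i * gbar x $ p $ j)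
        - psi g gbar x i * gbar x $ k $ j - psi g gbar x k * gbar x $ i $ j
        - (\<Sum>\<alpha>\<in>UNIV. xi g gbar x \<alpha> k i * gbar x $ \<alpha> $ j)"
      by (simp add: D_def left_diff_distrib sum_subtractf if_distrib[of "\<lambda>t. t * _"] cong: if_cong)
    moreover have "(\<Sum>p\<in>UNIV. D p k j * gbar x $ i $ p) = (\<Sum>p\<in>UNIV. deform g gbar x p k j * gbar x $ i $ p)
        - psi g gbar x j * gbar x $ i $ k - psi g gbar x k * gbar x $ i $ j
        - (\<Sum>\<alpha>\<in>UNIV. xi g gbar x \<alpha> k j * gbar x $ i $ \<alpha>)"
      by (simp add: D_def left_diff_distrib sum_subtractf if_distrib[of "\<lambda>t. t * _"] cong: if_cong)
    ultimately show ?thesis using cov3_02_deform[OF assms, of g i j k] by simp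
  qed
  have gd: "geodesic_deformation g gbar x \<longleftrightarrow> (\<forall>p k i. D p k i = 0)"
    unfolding geodesic_deformation_def D_def by (auto simp: algebra_simps)
  show ?thesis
  proof
    assume "geodesic_deformation g gbar x"
    then show "\<forall>i j k. cov3_02 (Gamma g) gbar x i j k =
         cov3_02 (Gamma gbar) (\<lambda>y. alt_part (gbar y)) x i j k
         + 2 * psi g gbar x k * gbar x $ i $ j
         + psi g gbar x i * gbar x $ k $ j + psi g gbar x j * gbar x $ i $ k
         + (\<Sum>\<alpha>\<in>UNIV. xi g gbar x \<alpha> k i * gbar x $ \<alpha> $ j)
         + (\<Sum>\<alpha>\<in>UNIV. xi g gbar x \<alpha> k j * gbar x $ i $ \<alpha>)"
      using * gd by simp
  next
    assume "\<forall>i j k. cov3_02 (Gamma g) gbar x i j k =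
         cov3_02 (Gamma gbar) (\<lambda>y. alt_part (gbar y)) x i j k
         + 2 * psi g gbar x k * gbar x $ i $ j
         + psi g gbar x i * gbar x $ k $ j + psi g gbar x j * gbar x $ i $ k
         + (\<Sum>\<alpha>\<in>UNIV. xi g gbar x \<alpha> k i * gbar x $ \<alpha> $ j)
         + (\<Sum>\<alpha>\<in>UNIV. xi g gbar x \<alpha> k j * gbar x $ i $ \<alpha>)"
    then have "D p k i = 0" for p k i
      by (intro metric_preserving_symmetric_zero[OF sym _ assms(2)]) (simp add: *)
    then show "geodesic_deformation g gbar x" by (simp add: gd)
  qed
qed

lemma structure_condition_of_geodesic_deformation:
  assumes "geodesic_deformation g gbar x"
  shows "cov3_11 (Gamma g) F x h i k =
         cov3_11 (Gamma gbar) F x h i k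
         - (\<Sum>p\<in>UNIV. psi g gbar x p * (if h = k then 1 else 0) * F x $ p $ i)
         + psi g gbar x i * F x $ h $ k
         - (\<Sum>p\<in>UNIV. xi g gbar x h p k * F x $ p $ i)
         + (\<Sum>p\<in>UNIV. xi g gbar x p k i * F x $ h $ p)"
proof -
  have d: "deform g gbar x i j k
      = (if i = j then psi g gbar x k else 0) + (if i = k then psi g gbar x j else 0) + xi g gbar x i j k"
    for i j k using assms unfolding geodesic_deformation_def by blast
  have "(\<Sum>p\<in>UNIV. deform g gbar x p k i * F x $ h $ p)
      = psi g gbar x i * F x $ h $ k + psi g gbar x k * F x $ h $ i
        + (\<Sum>p\<in>UNIV. xi g gbar x p k i * F x $ h $ p)"
    by (simp add: d distrib_right sum.distrib if_distrib[of "\<lambda>t. t * _"] cong: if_cong)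
  moreover have "(\<Sum>p\<in>UNIV. deform g gbar x h p k * F x $ p $ i)
      = psi g gbar x k * F x $ h $ i + (\<Sum>p\<in>UNIV. psi g gbar x p * (if h = k then 1 else 0) * F x $ p $ i)
        + (\<Sum>p\<in>UNIV. xi g gbar x h p k * F x $ p $ i)"
    by (simp add: d distrib_right sum.distrib if_distrib[of "\<lambda>t. t * _"] cong: if_cong)
  ultimately show ?thesis using cov3_11_deform[of g F x h i k gbar] by simp
qed

section \<open>Almost complex structures and compatible forms\<close>

lemma matrix_minus_mult:
  fixes A :: "real ^ 'n ^ 'm" and B :: "real ^ 'k ^ 'n"
  shows "(- A) ** B = - (A ** B)" "A ** (- B) = - (A ** B)"
  by (simp_all add: matrix_matrix_mult_def vec_eq_iff sum_negf)

text \<open>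
  Either equation becomes the other one on multiplication by \<open>F\<close> from the right, because
  \<open>F\<^sup>2 = -1\<close>.
\<close>

lemma hermitian_iff_skew:
  fixes F G :: "real ^ 'n ^ 'n"
  assumes F: "F ** F = - mat 1"
  shows "transpose F ** G ** F = G \<longleftrightarrow> transpose F ** G = - (G ** F)"
proof
  assume "transpose F ** G ** F = G"
  then have "G ** F = transpose F ** G ** (F ** F)" by (simp add: matrix_mul_assoc)
  then show "transpose F ** G = - (G ** F)" by (simp add: F matrix_minus_mult)
next
  assume "transpose F ** G = - (G ** F)"
  then have "transpose F ** G ** F = - (G ** (F ** F))" by (simp add: matrix_minus_mult matrix_mul_assoc)
  then show "transpose F ** G ** F = G" by (simp add: F matrix_minus_mult)
qed

text \<open>
  Multiplied by \<open>G\<close> inverse from both sides, skewness reads \<open>B F\<^sup>T = - F B\<close> with \<open>B\<close> the inverse of \<open>G\<close>;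
  applying \<open>F\<close> from the left turns the right-hand side into \<open>B\<close>.
\<close>

lemma skew_imp_inverse_hermitian:
  fixes F G :: "real ^ 'n ^ 'n"
  assumes F: "F ** F = - mat 1" and G: "det G \<noteq> 0" and s: "transpose F ** G = - (G ** F)"
  shows "F ** matrix_inv G ** transpose F = matrix_inv G"
proof -
  let ?B = "matrix_inv G"
  have "transpose F = transpose F ** G ** ?B"
    by (simp add: matrix_mul_assoc[symmetric] matrix_inv_mult[OF G])
  then have "?B ** transpose F = - (?B ** G ** F ** ?B)"
    by (simp add: s matrix_minus_mult matrix_mul_assoc)
  then have "?B ** transpose F = - (F ** ?B)" by (simp add: matrix_inv_mult[OF G])
  then have "F ** ?B ** transpose F = - (F ** F ** ?B)"
    by (metis matrix_minus_mult(2) matrix_mul_assoc)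
  then show ?thesis by (simp add: F matrix_minus_mult)
qed

lemma almost_complex_iff:
  fixes F :: "real ^ 'n ^ 'n"
  shows "(\<forall>h i. (\<Sum>p\<in>UNIV. F $ h $ p * F $ p $ i) = (if h = i then -1 else 0)) \<longleftrightarrow> F ** F = - mat 1"
  by (simp add: vec_eq_iff matrix_matrix_mult_def mat_def)

lemma skew_iff:
  fixes F A :: "real ^ 'n ^ 'n"
  shows "(\<forall>i j. (\<Sum>\<alpha>\<in>UNIV. F $ \<alpha> $ i * sym_part A $ \<alpha> $ j)
       + (\<Sum>\<alpha>\<in>UNIV. F $ \<alpha> $ j * sym_part A $ \<alpha> $ i) = 0)
    \<longleftrightarrow> transpose F ** sym_part A = - (sym_part A ** F)"
  by (simp add: vec_eq_iff matrix_matrix_mult_def transpose_def eq_neg_iff_add_eq_0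
      mult.commute[of "F $ _ $ _"] sym_part_sym[of A _ i for i])

lemma hermitian_iff:
  fixes F G :: "real ^ 'n ^ 'n"
  shows "(\<forall>i j. (\<Sum>p\<in>UNIV. \<Sum>q\<in>UNIV. G $ p $ q * F $ p $ i * F $ q $ j) = G $ i $ j)
    \<longleftrightarrow> transpose F ** G ** F = G"
proof -
  have "(transpose F ** G ** F) $ i $ j = (\<Sum>p\<in>UNIV. \<Sum>q\<in>UNIV. G $ p $ q * F $ p $ i * F $ q $ j)" for i j
    by (simp add: matrix_matrix_mult_def transpose_def sum_distrib_right sum_distrib_left mult_ac)
      (subst sum.swap, simp add: mult_ac)
  then show ?thesis by (simp add: vec_eq_iff)
qed

lemma inverse_hermitian_iff:
  fixes F H :: "real ^ 'n ^ 'n"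
  shows "(\<forall>i j. H $ i $ j = (\<Sum>p\<in>UNIV. \<Sum>q\<in>UNIV. H $ p $ q * F $ i $ p * F $ j $ q))
    \<longleftrightarrow> F ** H ** transpose F = H"
proof -
  have "transpose F $ p $ i = F $ i $ p" for p i by (simp add: transpose_def)
  then show ?thesis
    using hermitian_iff[of H "transpose F"]
    by (simp only: transpose_transpose eq_commute[of "H $ _ $ _"])
qed

section \<open>Geodesic mappings\<close>

text \<open>
  A symmetric vector-valued form whose quadratic form maps every vector to a multiple of itself is
  \<open>\<delta>^i_j t_k + \<delta>^i_k t_j\<close>. The test vectors are the \<open>e_j\<close>, giving \<open>S^i_jj = 0\<close> for \<open>i \<noteq> j\<close>, and
  \<open>e_j + e_k\<close>, \<open>e_j - e_k\<close>, whose values in the components \<open>j\<close> and \<open>k\<close>, compared, give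
  \<open>S^j_jj = 2 S^k_jk\<close>, while the other components give \<open>S^i_jk = 0\<close>. So
  \<open>t_j = S^j_jj / 2\<close>, and the trace of \<open>S\<close> is \<open>(N + 1) t_j\<close>.
\<close>

lemma direction_preserving_form:
  fixes S :: "'n::finite \<Rightarrow> 'n \<Rightarrow> 'n \<Rightarrow> real"
  assumes sym: "\<And>i j k. S i j k = S i k j"
    and dir: "\<And>v :: real ^ 'n. v \<noteq> 0 \<Longrightarrow>
      \<exists>\<rho>. \<forall>i. (\<Sum>j\<in>UNIV. \<Sum>k\<in>UNIV. S i j k * v $ j * v $ k) = \<rho> * v $ i"
  shows "S i j k = (if i = j then (\<Sum>\<alpha>\<in>UNIV. S \<alpha> k \<alpha>) / (real CARD('n) + 1) else 0)
    + (if i = k then (\<Sum>\<alpha>\<in>UNIV. S \<alpha> j \<alpha>) / (real CARD('n) + 1) else 0)"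
proof -
  have quad: "(\<Sum>a\<in>UNIV. \<Sum>b\<in>UNIV. S i a b * (axis j p + axis k q) $ a * (axis j p + axis k q) $ b)
      = p * p * S i j j + 2 * p * q * S i j k + q * q * S i k k" for i j k and p q :: real
  proof -
    have lin: "(\<Sum>a\<in>UNIV. f a * (axis j p + axis k q) $ a) = f j * p + f k * q" for f
      by (simp add: axis_def distrib_left sum.distrib if_distrib[of "\<lambda>t. _ * t"] cong: if_cong)
    have "(\<Sum>a\<in>UNIV. \<Sum>b\<in>UNIV. S i a b * (axis j p + axis k q) $ a * (axis j p + axis k q) $ b)
        = (\<Sum>a\<in>UNIV. S i a j * (axis j p + axis k q) $ a * p + S i a k * (axis j p + axis k q) $ a * q)"
      by (simp only: lin)
    also have "\<dots> = (S i j j * p + S i k j * q) * p + (S i j k * p + S i k k * q) * q"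
      by (simp only: lin sum.distrib sum_distrib_right[symmetric])
    finally show ?thesis by (simp add: algebra_simps sym[of i k j])
  qed
  have diag: "S i j j = 0" if "i \<noteq> j" for i j
  proof -
    have "axis j (1::real) \<noteq> 0" by (simp add: axis_eq_0_iff)
    \<comment> \<open>The vector \<open>e_j\<close> is taken as \<open>1 e_j + 0 e_j\<close>, so that the expansion above applies.\<close>
    from dir[OF this] quad[of i j 1 j 0] that show ?thesis
      by (auto simp: axis_def)
  qed
  have e1: "S j j j = 2 * S k j k" and e2: "i \<noteq> j \<Longrightarrow> i \<noteq> k \<Longrightarrow> S i j k = 0" if jk: "j \<noteq> k" for i j k
  proof -
    have val: "\<exists>\<rho>. \<forall>i. S i j j + 2 * q * S i j k + q * q * S i k k = \<rho> * (axis j 1 + axis k q) $ i" for q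
    proof -
      have "axis j 1 + axis k q \<noteq> (0 :: real ^ 'n)"
        using jk by (auto simp: vec_eq_iff axis_def dest!: spec[of _ j])
      from dir[OF this] show ?thesis unfolding quad by simp
    qed
    obtain r where r: "\<And>i. S i j j + 2 * S i j k + S i k k = r * (axis j 1 + axis k 1) $ i"
      using val[of 1] by auto
    obtain s where s: "\<And>i. S i j j - 2 * S i j k + S i k k = s * (axis j 1 + axis k (-1)) $ i"
      using val[of "-1"] by auto
    show "S j j j = 2 * S k j k"
      using r[of j] r[of k] s[of j] s[of k] diag[of j k] diag[of k j] jk by (auto simp: axis_def)
    show "S i j k = 0" if "i \<noteq> j" "i \<noteq> k"
      using r[of i] that diag[of i j] diag[of i k] by (auto simp: axis_def)
  qed
  have form: "S i j k = (if i = j then S k k k / 2 else 0) + (if i = k then S j j j / 2 else 0)" for i j k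
  proof (cases "j = k")
    case True
    then show ?thesis using diag[of i k] by simp
  next
    case False
    then show ?thesis using e1[of j k] e1[of k j] e2[of j k i] sym[of j k j] by force
  qed
  have "(\<Sum>\<alpha>\<in>UNIV. S \<alpha> j \<alpha>) = (real CARD('n) + 1) * (S j j j / 2)" for j
    by (subst form) (simp add: sum.distrib distrib_right)
  then have trace: "(\<Sum>\<alpha>\<in>UNIV. S \<alpha> j \<alpha>) / (real CARD('n) + 1) = S j j j / 2" for j
    by (simp add: field_simps)
  show ?thesis unfolding trace by (rule form)
qed

text \<open>
  Geodesics do not see torsion, since the velocity enters their equation quadratically.
\<close>

lemma deform_sym_conn_quadratic:
  "(\<Sum>j\<in>UNIV. \<Sum>k\<in>UNIV. sym_conn (deform g gbar) x i j k * v $ j * v $ k)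
    = (\<Sum>j\<in>UNIV. \<Sum>k\<in>UNIV. deform g gbar x i j k * v $ j * v $ k)"
proof -
  have "(\<Sum>j\<in>UNIV. \<Sum>k\<in>UNIV. xi g gbar x i j k * v $ j * v $ k) = 0"
    using symmetric_alternating_contraction[of "\<lambda>j k. v $ j * v $ k" "\<lambda>j k. xi g gbar x i j k"]
    by (simp add: mult_ac xi_def field_simps)
  moreover have "deform g gbar x i j k = sym_conn (deform g gbar) x i j k + xi g gbar x i j k" for j k
    by (simp add: sym_conn_def xi_def field_simps)
  ultimately show ?thesis by (simp add: distrib_right sum.distrib)
qed

lemma geodesic_deformation_iff_sym_conn:
  "geodesic_deformation g gbar x \<longleftrightarrow> (\<forall>i j k. sym_conn (deform g gbar) x i j k
     = (if i = j then psi g gbar x k else 0) + (if i = k then psi g gbar x j else 0))"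
proof -
  have "deform g gbar x i j k = sym_conn (deform g gbar) x i j k + xi g gbar x i j k" for i j k
    by (simp add: sym_conn_def xi_def field_simps)
  then show ?thesis unfolding geodesic_deformation_def by (metis add_right_cancel)
qed

lemma psi_eq_sym_trace:
  fixes g gbar :: "'n::finite field2"
  assumes "det (sym_part (g x)) \<noteq> 0" "det (sym_part (gbar x)) \<noteq> 0"
  shows "psi g gbar x j = (\<Sum>\<alpha>\<in>UNIV. sym_conn (deform g gbar) x \<alpha> j \<alpha>) / (real CARD('n) + 1)"
proof -
  have "deform g gbar x \<alpha> j \<alpha> = sym_conn (deform g gbar) x \<alpha> j \<alpha> + xi g gbar x \<alpha> j \<alpha>" for \<alpha>
    by (simp add: sym_conn_def xi_def field_simps)
  then have "(\<Sum>\<alpha>\<in>UNIV. deform g gbar x \<alpha> j \<alpha>) = (\<Sum>\<alpha>\<in>UNIV. sym_conn (deform g gbar) x \<alpha> j \<alpha>)"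
    using xi_trace_zero[where g = g and gbar = gbar, OF assms] by (simp add: sum.distrib)
  then show ?thesis by (simp add: psi_def deform_def)
qed

text \<open>
  A geodesic of both spaces has one velocity and one acceleration, whichever space it is regarded in.
  Subtracting the two equations at a point leaves \<open>P(v,v)\<close> parallel to \<open>v\<close>.
\<close>

lemma geodesic_mapping_imp_deformation:
  assumes g: "gen_Riemannian U g" and gb: "det (sym_part (gbar x)) \<noteq> 0"
    and gm: "geodesic_mapping U g gbar" and x: "x \<in> U"
  shows "geodesic_deformation g gbar x"
proof -
  have dg: "det (sym_part (g x)) \<noteq> 0" using g x by (simp add: gen_Riemannian_def)
  have dir: "\<exists>\<rho>. \<forall>i. (\<Sum>j\<in>UNIV. \<Sum>k\<in>UNIV. sym_conn (deform g gbar) x i j k * v $ j * v $ k) = \<rho> * v $ i"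
    if v: "v \<noteq> 0" for v
  proof -
    obtain J \<gamma> w a where geo: "geodesic U g J \<gamma>" and J: "0 \<in> J" and \<gamma>0: "\<gamma> 0 = x" and w0: "w 0 = v"
      and w: "\<And>t. t \<in> J \<Longrightarrow> (\<gamma> has_vector_derivative w t) (at t)"
      and a: "(w has_vector_derivative a) (at 0)"
      and ai: "\<And>i. a $ i = - (\<Sum>j\<in>UNIV. \<Sum>k\<in>UNIV. Gamma g x i j k * v $ j * v $ k)"
      by (rule geodesic_through_point_and_direction[OF g x v]) (rule that)
    have "geodesic U gbar J \<gamma>" using gm geo by (simp add: geodesic_mapping_def)
    then obtain w' a' \<rho> where oJ: "open J"
      and *: "\<forall>t\<in>J. (\<gamma> has_vector_derivative w' t) (at t) \<and> (w' has_vector_derivative a' t) (at t) \<and>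
        w' t \<noteq> 0 \<and> (\<forall>i. a' t $ i
          + (\<Sum>j\<in>UNIV. \<Sum>k\<in>UNIV. Gamma gbar (\<gamma> t) i j k * w' t $ j * w' t $ k) = \<rho> t * w' t $ i)"
      unfolding geodesic_def by blast
    have w': "(\<gamma> has_vector_derivative w' t) (at t)" and a': "(w' has_vector_derivative a' t) (at t)"
      and eq: "\<And>i. a' t $ i
        + (\<Sum>j\<in>UNIV. \<Sum>k\<in>UNIV. Gamma gbar (\<gamma> t) i j k * w' t $ j * w' t $ k) = \<rho> t * w' t $ i"
      if "t \<in> J" for t using * that by blast+
    have ww: "w' t = w t" if "t \<in> J" for t using vector_derivative_unique_at[OF w' w] that by blast
    have "(w has_vector_derivative a' 0) (at 0)"
      using has_vector_derivative_transform_within_open[OF a'[OF J] oJ J] ww by blast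
    then have "a' 0 = a" using a by (rule vector_derivative_unique_at)
    then have "(\<Sum>j\<in>UNIV. \<Sum>k\<in>UNIV. deform g gbar x i j k * v $ j * v $ k) = \<rho> 0 * v $ i" for i
      using eq[OF J, of i] ai[of i] \<gamma>0 w0 ww[OF J]
      by (simp add: deform_def left_diff_distrib sum_subtractf)
    then show ?thesis unfolding deform_sym_conn_quadratic by blast
  qed
  have sym: "sym_conn (deform g gbar) x i j k = sym_conn (deform g gbar) x i k j" for i j k
    by (simp add: sym_conn_def add.commute)
  show ?thesis
    unfolding geodesic_deformation_iff_sym_conn psi_eq_sym_trace[where g = g and gbar = gbar, OF dg gb]
    using direction_preserving_form[of "sym_conn (deform g gbar) x", OF sym dir] by blast
qed

text \<open>
  The parameter, velocity and acceleration stay the same; only the factor \<open>\<rho>\<close> grows by \<open>2 \<psi>(v)\<close>.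
\<close>

lemma deformation_imp_geodesic_mapping:
  assumes gd: "\<And>x. x \<in> U \<Longrightarrow> geodesic_deformation g gbar x"
  shows "geodesic_mapping U g gbar"
  unfolding geodesic_mapping_def
proof (intro allI impI)
  fix J \<gamma> assume "geodesic U g J \<gamma>"
  then obtain v a \<rho> where J: "open J" "is_interval J" "J \<noteq> {}" "\<gamma> ` J \<subseteq> U" and ca: "continuous_on J a"
    and *: "\<forall>t\<in>J. (\<gamma> has_vector_derivative v t) (at t) \<and> (v has_vector_derivative a t) (at t) \<and>
      v t \<noteq> 0 \<and> (\<forall>i. a t $ i
        + (\<Sum>j\<in>UNIV. \<Sum>k\<in>UNIV. Gamma g (\<gamma> t) i j k * v t $ j * v t $ k) = \<rho> t * v t $ i)"
    unfolding geodesic_def by blast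
  have v: "(\<gamma> has_vector_derivative v t) (at t)" and a: "(v has_vector_derivative a t) (at t)"
    and nz: "v t \<noteq> 0"
    and eq: "\<And>i. a t $ i
      + (\<Sum>j\<in>UNIV. \<Sum>k\<in>UNIV. Gamma g (\<gamma> t) i j k * v t $ j * v t $ k) = \<rho> t * v t $ i"
    if "t \<in> J" for t using * that by blast+
  have eq': "a t $ i + (\<Sum>j\<in>UNIV. \<Sum>k\<in>UNIV. Gamma gbar (\<gamma> t) i j k * v t $ j * v t $ k)
      = (\<rho> t + 2 * (\<Sum>k\<in>UNIV. psi g gbar (\<gamma> t) k * v t $ k)) * v t $ i" if t: "t \<in> J" for t i
  proof -
    let ?x = "\<gamma> t"
    have "?x \<in> U" using J(4) t by blast
    then have sc: "sym_conn (deform g gbar) ?x i j k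
        = (if i = j then psi g gbar ?x k else 0) + (if i = k then psi g gbar ?x j else 0)" for j k
      using gd[unfolded geodesic_deformation_iff_sym_conn] by blast
    have "(\<Sum>j\<in>UNIV. \<Sum>k\<in>UNIV. deform g gbar ?x i j k * v t $ j * v t $ k)
      = (\<Sum>j\<in>UNIV. (if i = j then \<Sum>k\<in>UNIV. psi g gbar ?x k * v t $ i * v t $ k else 0))
        + (\<Sum>j\<in>UNIV. psi g gbar ?x j * v t $ j * v t $ i)"
      unfolding deform_sym_conn_quadratic[symmetric] sc
      unfolding sum.distrib[symmetric]
    proof (intro sum.cong refl)
      fix j
      show "(\<Sum>k\<in>UNIV. ((if i = j then psi g gbar ?x k else 0) + (if i = k then psi g gbar ?x j else 0))
          * v t $ j * v t $ k)
        = (if i = j then \<Sum>k\<in>UNIV. psi g gbar ?x k * v t $ i * v t $ k else 0)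
          + psi g gbar ?x j * v t $ j * v t $ i"
        by (cases "i = j")
          (simp_all add: distrib_right sum.distrib if_distrib[of "\<lambda>t. t * _"] cong: if_cong)
    qed
    also have "\<dots> = 2 * (\<Sum>k\<in>UNIV. psi g gbar ?x k * v t $ k) * v t $ i"
      by (simp add: sum_distrib_left sum_distrib_right mult_ac)
    finally show ?thesis
      using eq[OF t, of i] by (simp add: deform_def left_diff_distrib sum_subtractf distrib_right)
  qed
  show "geodesic U gbar J \<gamma>"
    unfolding geodesic_def
    by (intro conjI J exI[of _ v] exI[of _ a] exI[of _ "\<lambda>t. \<rho> t + 2 * (\<Sum>k\<in>UNIV. psi g gbar (\<gamma> t) k * v t $ k)"]
        ca ballI allI v a nz eq')
qed

section \<open>Characterization of geodesic mappings onto generalized Kaehlerian spaces\<close>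

theorem theorem2p5:
  fixes U :: "(real ^ 'n::finite) set"
    and g gbar Fbar :: "real ^ 'n \<Rightarrow> real ^ 'n ^ 'n"
  assumes "gen_Riemannian U g"
    and "smooth_field2 U gbar" and "smooth_field2 U Fbar"
    and "structure_parallel U gbar Fbar"
  shows "gen_Kaehler1 U gbar Fbar \<and> nontrivial_geodesic_mapping U g gbar \<longleftrightarrow>
    (\<forall>x\<in>U. \<forall>i j k.
       cov3_02 (Gamma g) gbar x i j k =
         cov3_02 (Gamma gbar) (\<lambda>y. alt_part (gbar y)) x i j k
         + 2 * psi g gbar x k * gbar x $ i $ j
         + psi g gbar x i * gbar x $ k $ j + psi g gbar x j * gbar x $ i $ k
         + (\<Sum>\<alpha>\<in>UNIV. xi g gbar x \<alpha> k i * gbar x $ \<alpha> $ j)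
         + (\<Sum>\<alpha>\<in>UNIV. xi g gbar x \<alpha> k j * gbar x $ i $ \<alpha>)) \<and>
    (\<forall>x\<in>U. \<forall>h i k.
       cov3_11 (Gamma g) Fbar x h i k =
         cov3_11 (Gamma gbar) Fbar x h i k
         - (\<Sum>p\<in>UNIV. psi g gbar x p * (if h = k then 1 else 0) * Fbar x $ p $ i)
         + psi g gbar x i * Fbar x $ h $ k
         - (\<Sum>p\<in>UNIV. xi g gbar x h p k * Fbar x $ p $ i)
         + (\<Sum>p\<in>UNIV. xi g gbar x p k i * Fbar x $ h $ p)) \<and>
    psi_nonzero U g gbar \<and>
    (\<forall>x\<in>U. det (sym_part (gbar x)) \<noteq> 0) \<and>
    (\<forall>x\<in>U. \<forall>i j. (\<Sum>\<alpha>\<in>UNIV. Fbar x $ \<alpha> $ i * sym_part (gbar x) $ \<alpha> $ j)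
       + (\<Sum>\<alpha>\<in>UNIV. Fbar x $ \<alpha> $ j * sym_part (gbar x) $ \<alpha> $ i) = 0) \<and>
    (\<forall>x\<in>U. \<forall>h i. (\<Sum>\<alpha>\<in>UNIV. Fbar x $ h $ \<alpha> * Fbar x $ \<alpha> $ i) = (if h = i then -1 else 0))"
    (is "?K \<and> ?M \<longleftrightarrow> ?a \<and> ?b \<and> ?n \<and> ?d \<and> ?s \<and> ?c")
proof -
  have U: "open U" using assms(1) by (simp add: gen_Riemannian_def)
  have diff: "(\<lambda>y. gbar y $ i $ j) differentiable at x" if "x \<in> U" for x i j
    using assms(2) U that unfolding smooth_field2_def
    by (metis C_diff.simps(2) differentiable_on_eq_differentiable_at)
  \<comment> \<open>Smoothness and parallelism of the structure are assumed, so only the algebra of the definition is left.\<close>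
  have K: "?K \<longleftrightarrow> ?d \<and> ?s \<and> ?c"
  proof -
    have "?K \<longleftrightarrow> ?d \<and> (\<forall>x\<in>U. Fbar x ** Fbar x = - mat 1)
        \<and> (\<forall>x\<in>U. transpose (Fbar x) ** sym_part (gbar x) ** Fbar x = sym_part (gbar x))
        \<and> (\<forall>x\<in>U. Fbar x ** matrix_inv (sym_part (gbar x)) ** transpose (Fbar x) = matrix_inv (sym_part (gbar x)))"
      unfolding gen_Kaehler1_def gen_Riemannian_def almost_complex_iff hermitian_iff inverse_hermitian_iff
      using U assms(2-4) by blast
    then show ?thesis
      unfolding almost_complex_iff skew_iff
      using hermitian_iff_skew skew_imp_inverse_hermitian by blast
  qed
  have M: "?M \<longleftrightarrow> ?a \<and> ?n" if ?d
  proof -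
    have "geodesic_mapping U g gbar \<longleftrightarrow> (\<forall>x\<in>U. geodesic_deformation g gbar x)"
      using geodesic_mapping_imp_deformation[OF assms(1)] deformation_imp_geodesic_mapping that by blast
    also have "\<dots> \<longleftrightarrow> ?a"
      using metric_condition_iff_geodesic_deformation[OF diff, of _ g] that by blast
    finally show ?thesis unfolding nontrivial_geodesic_mapping_def by blast
  qed
  have b: "?b" if ?d ?a
    using metric_condition_iff_geodesic_deformation[OF diff, of _ g]
      structure_condition_of_geodesic_deformation that by blast
  show ?thesis using K M b by blast
qed

end
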